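(* Let $S$ be a small set (of sorts) and let $(I,\mathsf{ar})$ be a multi-sorted binding signature over $S$. Let $\mathcal C$ be a category with a terminal object $\top$, binary products, set-indexed coproducts and limits of $\omega$-cochains. Let $H:[\mathcal C^S,\mathcal C^S]\to[\mathcal C^S,\mathcal C^S]$ be the signature functor associated with $(I,\mathsf{ar})$. (1) If in $\mathcal C$ $\omega$-limits distribute over $J$-indexed coproducts for every subsingleton $J$ and for $J=I$, then $H$ is $\omega$-continuous. (2) If moreover in $\mathcal C$ $\omega$-limits distribute over $J$-indexed coproducts for a two-element set $J$, then the functor $\mathsf{Id}+H{-}$ on $[\mathcal C^S,\mathcal C^S]$ is $\omega$-continuous, and it has a final coalgebra.
   Context: Composition (of morphisms and of functors) is written in diagrammatic order: $F\cdot G$ means first $F$, then $G$. $\mathcal C^S$ is the functor category $[S,\mathcal C]$ with $S$ viewed as a discrete category; for an object $\xi$ of $\mathcal C^S$ and $s\in S$ its value is written $\xi\,s$. $A^*$ is the set of finite lists over $A$. $\mathsf{Id}$ is the identity functor on $\mathcal C^S$, and $+$ is the (pointwise) binary coproduct. A multi-sorted binding signature over $S$ is a small set $I$ with a function $\mathsf{ar}:I\to(S^*\times S)^*\times S$. $\omega$-limits are limits of diagrams of shape $0\leftarrow1\leftarrow2\leftarrow\cdots$; a functor is $\omega$-continuous if it preserves them. $\omega$-limits distribute over $J$-coproducts if for every $J$-indexed family of such diagrams $(x_{j,n})_n$ the canonical morphism $\coprod_{j}\lim_n x_{j,n}\to\lim_n\coprod_j x_{j,n}$ is an isomorphism. A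 subsingleton is a set with at most one element. The signature functor $H$ is built as follows (functorial actions on morphisms are the evident ones). - For $s\in S$, $\mathsf{option}_s:\mathcal C^S\to\mathcal C^S$, $\mathsf{option}_s\,\xi\,t:=(\coprod_{(s=t)}\top)+\xi\,t$, where the coproduct is indexed by the subsingleton of proofs of $s=t$ (one copy of $\top$ if $s=t$, the empty coproduct otherwise). - For a list $\ell=[s_1,\dots,s_n]$, $\mathsf{option}^*\,\ell:=\mathsf{option}_{s_1}\cdot(\mathsf{option}_{s_2}\cdot\ldots)$, and $\mathsf{option}^*\,[]:=\mathsf{Id}$. - For $s\in S$, $\mathsf{pr}_s:\mathcal C^S\to\mathcal C$, $\mathsf{pr}_s\,\xi:=\xi\,s$; and $\hat s:\mathcal C\to\mathcal C^S$, $\hat s\,c\,t:=\coprod_{(s=t)}c$ (left adjoint to $\mathsf{pr}_s$). - For $a=(\ell,s)\in S^*\times S$ and $t\in S$, $G^{(a,t)}X:=\mathsf{option}^*\,\ell\cdot X\cdot\mathsf{pr}_s\cdot\hat t$ for $X:[\mathcal C^S,\mathcal C^S]$. - For a non-empty list $\vec a=[a_1,\dots,a_n]$ and $t\in S$, $G^{(\vec a,t)}X:=G^{(a_1,t)}X\times(G^{(a_2,t)}X\times\cdots)$ (pointwise binary products, ending with $G^{(a_n,t)}X$); for the empty list, $G^{([],t)}X:=\top_{[\mathcal C^S,\mathcal C]}\cdot\hat t$, i.e. constantly $\hat t\,\top$, independently of $X$. - $HX:=\coprod_{i\in I}G^{\mathsf{ar}(i)}X$ (pointwise coproduct). *)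

theory Defs
  imports "HOL-Library.FuncSet"
begin

section \<open>Categories, functors, natural transformations\<close>

text \<open>Composition is written in diagrammatic order: \<open>f \<cdot>\<^bsub>C\<^esub> g\<close> is first \<open>f\<close>, then \<open>g\<close>.\<close>

record ('o, 'm) cat =
  Ob :: "'o set"
  Arr :: "'m set"
  Dom :: "'m \<Rightarrow> 'o"
  Cod :: "'m \<Rightarrow> 'o"
  Ident :: "'o \<Rightarrow> 'm"
  Comp :: "'m \<Rightarrow> 'm \<Rightarrow> 'm" (infixl "\<cdot>\<index>" 70)

definition hom :: "('o, 'm) cat \<Rightarrow> 'o \<Rightarrow> 'o \<Rightarrow> 'm set" where
  "hom C a b = {f \<in> Arr C. Dom C f = a \<and> Cod C f = b}"

locale category =
  fixes C :: "('o, 'm) cat" (structure)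
  assumes dom_in: "f \<in> Arr C \<Longrightarrow> Dom C f \<in> Ob C"
    and cod_in: "f \<in> Arr C \<Longrightarrow> Cod C f \<in> Ob C"
    and id_hom: "a \<in> Ob C \<Longrightarrow> Ident C a \<in> hom C a a"
    and comp_hom: "f \<in> hom C a b \<Longrightarrow> g \<in> hom C b c \<Longrightarrow> f \<cdot> g \<in> hom C a c"
    and id_comp: "f \<in> hom C a b \<Longrightarrow> Ident C a \<cdot> f = f"
    and comp_id: "f \<in> hom C a b \<Longrightarrow> f \<cdot> Ident C b = f"
    and comp_assoc: "f \<in> hom C a b \<Longrightarrow> g \<in> hom C b c \<Longrightarrow> h \<in> hom C c d \<Longrightarrow>
      (f \<cdot> g) \<cdot> h = f \<cdot> (g \<cdot> h)"

definition is_iso :: "('o, 'm) cat \<Rightarrow> 'm \<Rightarrow> bool" where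
  "is_iso C f \<longleftrightarrow> f \<in> Arr C \<and>
     (\<exists>g \<in> hom C (Cod C f) (Dom C f).
        f \<cdot>\<^bsub>C\<^esub> g = Ident C (Dom C f) \<and> g \<cdot>\<^bsub>C\<^esub> f = Ident C (Cod C f))"

text \<open>Functors and natural transformations are required to be \<open>undefined\<close> off their domain,
  so that equality of functors and of transformations is HOL equality.\<close>

record ('o, 'm, 'p, 'n) fctr =
  FOb :: "'o \<Rightarrow> 'p"
  FArr :: "'m \<Rightarrow> 'n"

definition is_functor :: "('o, 'm) cat \<Rightarrow> ('p, 'n) cat \<Rightarrow> ('o, 'm, 'p, 'n) fctr \<Rightarrow> bool" where
  "is_functor A B F \<longleftrightarrow>
     FOb F \<in> Ob A \<rightarrow>\<^sub>E Ob B \<and>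
     FArr F \<in> extensional (Arr A) \<and>
     (\<forall>f \<in> Arr A. FArr F f \<in> hom B (FOb F (Dom A f)) (FOb F (Cod A f))) \<and>
     (\<forall>a \<in> Ob A. FArr F (Ident A a) = Ident B (FOb F a)) \<and>
     (\<forall>f \<in> Arr A. \<forall>g \<in> Arr A. Cod A f = Dom A g \<longrightarrow>
        FArr F (f \<cdot>\<^bsub>A\<^esub> g) = FArr F f \<cdot>\<^bsub>B\<^esub> FArr F g)"

record ('o, 'm, 'p, 'n) ntrans =
  NDom :: "('o, 'm, 'p, 'n) fctr"
  NCod :: "('o, 'm, 'p, 'n) fctr"
  NMap :: "'o \<Rightarrow> 'n"

definition is_ntrans :: "('o, 'm) cat \<Rightarrow> ('p, 'n) cat \<Rightarrow> ('o, 'm, 'p, 'n) ntrans \<Rightarrow> bool" where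
  "is_ntrans A B \<alpha> \<longleftrightarrow>
     is_functor A B (NDom \<alpha>) \<and> is_functor A B (NCod \<alpha>) \<and>
     NMap \<alpha> \<in> extensional (Ob A) \<and>
     (\<forall>a \<in> Ob A. NMap \<alpha> a \<in> hom B (FOb (NDom \<alpha>) a) (FOb (NCod \<alpha>) a)) \<and>
     (\<forall>f \<in> Arr A. FArr (NDom \<alpha>) f \<cdot>\<^bsub>B\<^esub> NMap \<alpha> (Cod A f) =
                  NMap \<alpha> (Dom A f) \<cdot>\<^bsub>B\<^esub> FArr (NCod \<alpha>) f)"

definition functor_cat :: "('o, 'm) cat \<Rightarrow> ('p, 'n) cat \<Rightarrow>
    (('o, 'm, 'p, 'n) fctr, ('o, 'm, 'p, 'n) ntrans) cat" where
  "functor_cat A B =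
     \<lparr> Ob = {F. is_functor A B F},
       Arr = {\<alpha>. is_ntrans A B \<alpha>},
       Dom = NDom,
       Cod = NCod,
       Ident = (\<lambda>F. \<lparr> NDom = F, NCod = F, NMap = (\<lambda>a \<in> Ob A. Ident B (FOb F a)) \<rparr>),
       Comp = (\<lambda>\<alpha> \<beta>. \<lparr> NDom = NDom \<alpha>, NCod = NCod \<beta>,
                        NMap = (\<lambda>a \<in> Ob A. NMap \<alpha> a \<cdot>\<^bsub>B\<^esub> NMap \<beta> a) \<rparr>) \<rparr>"

definition id_functor :: "('o, 'm) cat \<Rightarrow> ('o, 'm, 'o, 'm) fctr" where
  "id_functor A = \<lparr> FOb = (\<lambda>a \<in> Ob A. a), FArr = (\<lambda>f \<in> Arr A. f) \<rparr>"

definition const_functor :: "('o, 'm) cat \<Rightarrow> ('p, 'n) cat \<Rightarrow> 'p \<Rightarrow> ('o, 'm, 'p, 'n) fctr" where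
  "const_functor A B b = \<lparr> FOb = (\<lambda>a \<in> Ob A. b), FArr = (\<lambda>f \<in> Arr A. Ident B b) \<rparr>"

text \<open>\<open>comp_functor A F G\<close> is \<open>F \<cdot> G\<close> (first \<open>F\<close>) for \<open>F\<close> with source category \<open>A\<close>.\<close>

definition comp_functor :: "('o, 'm) cat \<Rightarrow> ('o, 'm, 'p, 'n) fctr \<Rightarrow> ('p, 'n, 'q, 'r) fctr \<Rightarrow>
    ('o, 'm, 'q, 'r) fctr" where
  "comp_functor A F G =
     \<lparr> FOb = (\<lambda>a \<in> Ob A. FOb G (FOb F a)), FArr = (\<lambda>f \<in> Arr A. FArr G (FArr F f)) \<rparr>"

text \<open>For \<open>K : A \<rightarrow> B\<close> and \<open>L : B' \<rightarrow> E\<close>, the functor \<open>X \<mapsto> K \<cdot> X \<cdot> L\<close> from \<open>[B, B']\<close> to \<open>[A, E]\<close>,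
  acting on transformations by whiskering.\<close>

definition whisker_functor :: "('o, 'm) cat \<Rightarrow> ('p, 'n) cat \<Rightarrow> ('q, 'r) cat \<Rightarrow>
    ('o, 'm, 'p, 'n) fctr \<Rightarrow> ('q, 'r, 'x, 'y) fctr \<Rightarrow>
    (('p, 'n, 'q, 'r) fctr, ('p, 'n, 'q, 'r) ntrans, ('o, 'm, 'x, 'y) fctr, ('o, 'm, 'x, 'y) ntrans) fctr"
  where
  "whisker_functor A B B' K L =
     (let W = (\<lambda>X. comp_functor A K (comp_functor B X L)) in
      \<lparr> FOb = (\<lambda>X \<in> Ob (functor_cat B B'). W X),
        FArr = (\<lambda>\<alpha> \<in> Arr (functor_cat B B').
          \<lparr> NDom = W (NDom \<alpha>), NCod = W (NCod \<alpha>),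
            NMap = (\<lambda>a \<in> Ob A. FArr L (NMap \<alpha> (FOb K a))) \<rparr>) \<rparr>)"

definition discrete :: "'s set \<Rightarrow> ('s, 's) cat" where
  "discrete S = \<lparr> Ob = S, Arr = S, Dom = (\<lambda>s. s), Cod = (\<lambda>s. s), Ident = (\<lambda>s. s), Comp = (\<lambda>s t. s) \<rparr>"

abbreviation power_cat :: "('o, 'm) cat \<Rightarrow> 's set \<Rightarrow>
    (('s, 's, 'o, 'm) fctr, ('s, 's, 'o, 'm) ntrans) cat" where
  "power_cat C S \<equiv> functor_cat (discrete S) C"

abbreviation "endo_cat A \<equiv> functor_cat A A"


section \<open>Terminal objects, products, coproducts\<close>

definition is_terminal :: "('o, 'm) cat \<Rightarrow> 'o \<Rightarrow> bool" where
  "is_terminal C T \<longleftrightarrow> T \<in> Ob C \<and> (\<forall>a \<in> Ob C. \<exists>!f. f \<in> hom C a T)"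

definition is_product :: "('o, 'm) cat \<Rightarrow> 'o \<Rightarrow> 'o \<Rightarrow> 'o \<Rightarrow> 'm \<Rightarrow> 'm \<Rightarrow> bool" where
  "is_product C a b p \<pi>1 \<pi>2 \<longleftrightarrow>
     p \<in> Ob C \<and> \<pi>1 \<in> hom C p a \<and> \<pi>2 \<in> hom C p b \<and>
     (\<forall>d \<in> Ob C. \<forall>f \<in> hom C d a. \<forall>g \<in> hom C d b.
        \<exists>!m. m \<in> hom C d p \<and> m \<cdot>\<^bsub>C\<^esub> \<pi>1 = f \<and> m \<cdot>\<^bsub>C\<^esub> \<pi>2 = g)"

definition is_coproduct :: "('o, 'm) cat \<Rightarrow> 'j set \<Rightarrow> ('j \<Rightarrow> 'o) \<Rightarrow> 'o \<Rightarrow> ('j \<Rightarrow> 'm) \<Rightarrow> bool" where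
  "is_coproduct C J x c \<iota> \<longleftrightarrow>
     c \<in> Ob C \<and> (\<forall>j \<in> J. \<iota> j \<in> hom C (x j) c) \<and>
     (\<forall>d \<in> Ob C. \<forall>f. (\<forall>j \<in> J. f j \<in> hom C (x j) d) \<longrightarrow>
        (\<exists>!m. m \<in> hom C c d \<and> (\<forall>j \<in> J. \<iota> j \<cdot>\<^bsub>C\<^esub> m = f j)))"

text \<open>Chosen binary products and chosen coproducts, as data. Families are passed in extensional form
  (\<open>undefined\<close> off the index set), so a choice depends on the members of the family only.\<close>

record ('o, 'm) prods =
  PObj :: "'o \<Rightarrow> 'o \<Rightarrow> 'o"
  Fst :: "'o \<Rightarrow> 'o \<Rightarrow> 'm"
  Snd :: "'o \<Rightarrow> 'o \<Rightarrow> 'm"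

record ('j, 'o, 'm) coprods =
  Coprod :: "'j set \<Rightarrow> ('j \<Rightarrow> 'o) \<Rightarrow> 'o"
  Inj :: "'j set \<Rightarrow> ('j \<Rightarrow> 'o) \<Rightarrow> 'j \<Rightarrow> 'm"

definition chosen_products :: "('o, 'm) cat \<Rightarrow> ('o, 'm) prods \<Rightarrow> bool" where
  "chosen_products C P \<longleftrightarrow>
     (\<forall>a \<in> Ob C. \<forall>b \<in> Ob C. is_product C a b (PObj P a b) (Fst P a b) (Snd P a b))"

definition chosen_coproducts :: "('o, 'm) cat \<Rightarrow> ('j, 'o, 'm) coprods \<Rightarrow> 'j set \<Rightarrow> bool" where
  "chosen_coproducts C K J \<longleftrightarrow>
     (\<forall>x \<in> J \<rightarrow>\<^sub>E Ob C. is_coproduct C J x (Coprod K J x) (Inj K J x))"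

definition prod_map :: "('o, 'm) cat \<Rightarrow> ('o, 'm) prods \<Rightarrow> 'm \<Rightarrow> 'm \<Rightarrow> 'm" where
  "prod_map C P f g =
     (THE m. m \<in> hom C (PObj P (Dom C f) (Dom C g)) (PObj P (Cod C f) (Cod C g)) \<and>
        m \<cdot>\<^bsub>C\<^esub> Fst P (Cod C f) (Cod C g) = Fst P (Dom C f) (Dom C g) \<cdot>\<^bsub>C\<^esub> f \<and>
        m \<cdot>\<^bsub>C\<^esub> Snd P (Cod C f) (Cod C g) = Snd P (Dom C f) (Dom C g) \<cdot>\<^bsub>C\<^esub> g)"

definition coprod_map :: "('o, 'm) cat \<Rightarrow> ('j, 'o, 'm) coprods \<Rightarrow> 'j set \<Rightarrow> ('j \<Rightarrow> 'm) \<Rightarrow> 'm" where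
  "coprod_map C K J f =
     (let x = (\<lambda>j \<in> J. Dom C (f j)); y = (\<lambda>j \<in> J. Cod C (f j)) in
      THE m. m \<in> hom C (Coprod K J x) (Coprod K J y) \<and>
        (\<forall>j \<in> J. Inj K J x j \<cdot>\<^bsub>C\<^esub> m = f j \<cdot>\<^bsub>C\<^esub> Inj K J y j))"

text \<open>Pointwise products and coproducts of functors from \<open>A\<close> to \<open>B\<close>, formed with the choice on \<open>B\<close>,
  and the resulting choices on \<open>[A, B]\<close>.\<close>

definition prod_functor :: "('o, 'm) cat \<Rightarrow> ('p, 'n) cat \<Rightarrow> ('p, 'n) prods \<Rightarrow>
    ('o, 'm, 'p, 'n) fctr \<Rightarrow> ('o, 'm, 'p, 'n) fctr \<Rightarrow> ('o, 'm, 'p, 'n) fctr" where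
  "prod_functor A B P F G =
     \<lparr> FOb = (\<lambda>a \<in> Ob A. PObj P (FOb F a) (FOb G a)),
       FArr = (\<lambda>f \<in> Arr A. prod_map B P (FArr F f) (FArr G f)) \<rparr>"

definition coprod_functor :: "('o, 'm) cat \<Rightarrow> ('p, 'n) cat \<Rightarrow> ('j, 'p, 'n) coprods \<Rightarrow>
    'j set \<Rightarrow> ('j \<Rightarrow> ('o, 'm, 'p, 'n) fctr) \<Rightarrow> ('o, 'm, 'p, 'n) fctr" where
  "coprod_functor A B K J F =
     \<lparr> FOb = (\<lambda>a \<in> Ob A. Coprod K J (\<lambda>j \<in> J. FOb (F j) a)),
       FArr = (\<lambda>f \<in> Arr A. coprod_map B K J (\<lambda>j. FArr (F j) f)) \<rparr>"

definition pointwise_prods :: "('o, 'm) cat \<Rightarrow> ('p, 'n) cat \<Rightarrow> ('p, 'n) prods \<Rightarrow>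
    (('o, 'm, 'p, 'n) fctr, ('o, 'm, 'p, 'n) ntrans) prods" where
  "pointwise_prods A B P =
     \<lparr> PObj = prod_functor A B P,
       Fst = (\<lambda>F G. \<lparr> NDom = prod_functor A B P F G, NCod = F,
                      NMap = (\<lambda>a \<in> Ob A. Fst P (FOb F a) (FOb G a)) \<rparr>),
       Snd = (\<lambda>F G. \<lparr> NDom = prod_functor A B P F G, NCod = G,
                      NMap = (\<lambda>a \<in> Ob A. Snd P (FOb F a) (FOb G a)) \<rparr>) \<rparr>"

definition pointwise_coprods :: "('o, 'm) cat \<Rightarrow> ('p, 'n) cat \<Rightarrow> ('j, 'p, 'n) coprods \<Rightarrow>
    ('j, ('o, 'm, 'p, 'n) fctr, ('o, 'm, 'p, 'n) ntrans) coprods" where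
  "pointwise_coprods A B K =
     \<lparr> Coprod = coprod_functor A B K,
       Inj = (\<lambda>J F j. \<lparr> NDom = F j, NCod = coprod_functor A B K J F,
                        NMap = (\<lambda>a \<in> Ob A. Inj K J (\<lambda>j \<in> J. FOb (F j) a) j) \<rparr>) \<rparr>"

text \<open>Binary coproducts are coproducts over the index type \<^typ>\<open>bool\<close>, with \<^const>\<open>True\<close> for the left summand.\<close>

definition sum_functor :: "('o, 'm) cat \<Rightarrow> ('p, 'n) cat \<Rightarrow> (bool, 'p, 'n) coprods \<Rightarrow>
    ('o, 'm, 'p, 'n) fctr \<Rightarrow> ('o, 'm, 'p, 'n) fctr \<Rightarrow> ('o, 'm, 'p, 'n) fctr" where
  "sum_functor A B K F G = coprod_functor A B K UNIV (case_bool F G)"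


section \<open>Limits of cochains\<close>

text \<open>A cochain consists of arrows \<open>d n : x (Suc n) \<rightarrow> x n\<close>.\<close>

definition cochain :: "('o, 'm) cat \<Rightarrow> (nat \<Rightarrow> 'o) \<Rightarrow> (nat \<Rightarrow> 'm) \<Rightarrow> bool" where
  "cochain C x d \<longleftrightarrow> (\<forall>n. x n \<in> Ob C \<and> d n \<in> hom C (x (Suc n)) (x n))"

definition omega_cone :: "('o, 'm) cat \<Rightarrow> (nat \<Rightarrow> 'o) \<Rightarrow> (nat \<Rightarrow> 'm) \<Rightarrow> 'o \<Rightarrow> (nat \<Rightarrow> 'm) \<Rightarrow> bool" where
  "omega_cone C x d L p \<longleftrightarrow>
     L \<in> Ob C \<and> (\<forall>n. p n \<in> hom C L (x n) \<and> p (Suc n) \<cdot>\<^bsub>C\<^esub> d n = p n)"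

definition omega_limit :: "('o, 'm) cat \<Rightarrow> (nat \<Rightarrow> 'o) \<Rightarrow> (nat \<Rightarrow> 'm) \<Rightarrow> 'o \<Rightarrow> (nat \<Rightarrow> 'm) \<Rightarrow> bool" where
  "omega_limit C x d L p \<longleftrightarrow> cochain C x d \<and> omega_cone C x d L p \<and>
     (\<forall>M q. omega_cone C x d M q \<longrightarrow> (\<exists>!m. m \<in> hom C M L \<and> (\<forall>n. m \<cdot>\<^bsub>C\<^esub> p n = q n)))"

definition has_omega_limits :: "('o, 'm) cat \<Rightarrow> bool" where
  "has_omega_limits C \<longleftrightarrow> (\<forall>x d. cochain C x d \<longrightarrow> (\<exists>L p. omega_limit C x d L p))"

definition omega_continuous :: "('o, 'm) cat \<Rightarrow> ('p, 'n) cat \<Rightarrow> ('o, 'm, 'p, 'n) fctr \<Rightarrow> bool" where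
  "omega_continuous A B F \<longleftrightarrow> is_functor A B F \<and>
     (\<forall>x d L p. omega_limit A x d L p \<longrightarrow>
        omega_limit B (\<lambda>n. FOb F (x n)) (\<lambda>n. FArr F (d n)) (FOb F L) (\<lambda>n. FArr F (p n)))"

text \<open>In the following definition \<open>(M, q)\<close> is a limit of the cochain of coproducts \<open>(c n, \<kappa> n)\<close>, whose
  connecting arrows \<open>e n\<close> are induced by the \<open>d j n\<close>; the equations on \<open>m\<close> say that it is the
  canonical morphism from the coproduct \<open>(Q, \<iota>)\<close> of the limits \<open>(L j, p j)\<close> to \<open>M\<close>.\<close>

definition omega_limits_distribute :: "('o, 'm) cat \<Rightarrow> 'j set \<Rightarrow> bool" where
  "omega_limits_distribute C J \<longleftrightarrow>
     (\<forall>x d L p Q \<iota> c \<kappa> e M q m.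
        (\<forall>j \<in> J. omega_limit C (x j) (d j) (L j) (p j)) \<longrightarrow>
        is_coproduct C J L Q \<iota> \<longrightarrow>
        (\<forall>n. is_coproduct C J (\<lambda>j. x j n) (c n) (\<kappa> n)) \<longrightarrow>
        (\<forall>n. e n \<in> hom C (c (Suc n)) (c n) \<and>
           (\<forall>j \<in> J. \<kappa> (Suc n) j \<cdot>\<^bsub>C\<^esub> e n = d j n \<cdot>\<^bsub>C\<^esub> \<kappa> n j)) \<longrightarrow>
        omega_limit C c e M q \<longrightarrow>
        m \<in> hom C Q M \<longrightarrow>
        (\<forall>j \<in> J. \<forall>n. \<iota> j \<cdot>\<^bsub>C\<^esub> m \<cdot>\<^bsub>C\<^esub> q n = p j n \<cdot>\<^bsub>C\<^esub> \<kappa> n j) \<longrightarrow>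
        is_iso C m)"

definition subsingleton :: "'j set \<Rightarrow> bool" where
  "subsingleton J \<longleftrightarrow> (\<forall>x \<in> J. \<forall>y \<in> J. x = y)"


section \<open>Final coalgebras\<close>

definition coalgebra :: "('o, 'm) cat \<Rightarrow> ('o, 'm, 'o, 'm) fctr \<Rightarrow> 'o \<Rightarrow> 'm \<Rightarrow> bool" where
  "coalgebra A F X c \<longleftrightarrow> X \<in> Ob A \<and> c \<in> hom A X (FOb F X)"

definition final_coalgebra :: "('o, 'm) cat \<Rightarrow> ('o, 'm, 'o, 'm) fctr \<Rightarrow> 'o \<Rightarrow> 'm \<Rightarrow> bool" where
  "final_coalgebra A F Z z \<longleftrightarrow> coalgebra A F Z z \<and>
     (\<forall>X c. coalgebra A F X c \<longrightarrow> (\<exists>!h. h \<in> hom A X Z \<and> c \<cdot>\<^bsub>A\<^esub> FArr F h = h \<cdot>\<^bsub>A\<^esub> z))"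


section \<open>Multi-sorted binding signatures and their signature functors\<close>

text \<open>The type \<open>'u\<close> plays the role of the universe of small sets: a small set is a \<^typ>\<open>'u set\<close>.\<close>

type_synonym 'u arg = "'u list \<times> 'u"
type_synonym 'u arity = "'u arg list \<times> 'u"

definition binding_signature :: "'u set \<Rightarrow> 'u set \<Rightarrow> ('u \<Rightarrow> 'u arity) \<Rightarrow> bool" where
  "binding_signature S I ar \<longleftrightarrow> ar \<in> I \<rightarrow> lists (lists S \<times> S) \<times> S"

text \<open>The subsingleton of proofs of \<open>s = t\<close>.\<close>

definition eq_proofs :: "'u \<Rightarrow> 'u \<Rightarrow> 'u set" where
  "eq_proofs s t = {u. u = s \<and> s = t}"

context
  fixes C :: "('o, 'm) cat"
    and T :: 'o                          \<comment> \<open>chosen terminal object\<close>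
    and P :: "('o, 'm) prods"
    and K :: "('u, 'o, 'm) coprods"      \<comment> \<open>set-indexed coproducts\<close>
    and Kbin :: "(bool, 'o, 'm) coprods"   \<comment> \<open>binary coproducts\<close>
    and S :: "'u set"
begin

definition proj_functor ::
    "'u \<Rightarrow> (('u, 'u, 'o, 'm) fctr, ('u, 'u, 'o, 'm) ntrans, 'o, 'm) fctr" where
  "proj_functor s =
     \<lparr> FOb = (\<lambda>\<xi> \<in> Ob (power_cat C S). FOb \<xi> s),
       FArr = (\<lambda>\<alpha> \<in> Arr (power_cat C S). NMap \<alpha> s) \<rparr>"

definition hat_obj :: "'u \<Rightarrow> 'o \<Rightarrow> ('u, 'u, 'o, 'm) fctr" where
  "hat_obj s c =
     (let h = (\<lambda>t. Coprod K (eq_proofs s t) (\<lambda>_ \<in> eq_proofs s t. c)) in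
      \<lparr> FOb = (\<lambda>t \<in> S. h t), FArr = (\<lambda>t \<in> S. Ident C (h t)) \<rparr>)"

definition hat_functor ::
    "'u \<Rightarrow> ('o, 'm, ('u, 'u, 'o, 'm) fctr, ('u, 'u, 'o, 'm) ntrans) fctr" where
  "hat_functor s =
     \<lparr> FOb = (\<lambda>c \<in> Ob C. hat_obj s c),
       FArr = (\<lambda>f \<in> Arr C.
         \<lparr> NDom = hat_obj s (Dom C f), NCod = hat_obj s (Cod C f),
           NMap = (\<lambda>t \<in> S. coprod_map C K (eq_proofs s t) (\<lambda>_. f)) \<rparr>) \<rparr>"

text \<open>\<open>hat_obj s T\<close> is the family \<open>t \<mapsto> \<Coprod>\<^bsub>(s = t)\<^esub> T\<close>; see \<open>option_functor_apply\<close> below.\<close>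

definition option_functor :: "'u \<Rightarrow>
    (('u, 'u, 'o, 'm) fctr, ('u, 'u, 'o, 'm) ntrans, ('u, 'u, 'o, 'm) fctr, ('u, 'u, 'o, 'm) ntrans) fctr"
  where
  "option_functor s =
     sum_functor (power_cat C S) (power_cat C S) (pointwise_coprods (discrete S) C Kbin)
       (const_functor (power_cat C S) (power_cat C S) (hat_obj s T))
       (id_functor (power_cat C S))"

primrec options_functor :: "'u list \<Rightarrow>
    (('u, 'u, 'o, 'm) fctr, ('u, 'u, 'o, 'm) ntrans, ('u, 'u, 'o, 'm) fctr, ('u, 'u, 'o, 'm) ntrans) fctr"
  where
  "options_functor [] = id_functor (power_cat C S)"
| "options_functor (s # l) = comp_functor (power_cat C S) (option_functor s) (options_functor l)"

definition arg_functor where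
  "arg_functor a t =
     whisker_functor (power_cat C S) (power_cat C S) (power_cat C S) (options_functor (fst a))
       (comp_functor (power_cat C S) (proj_functor (snd a)) (hat_functor t))"

fun args_functor where
  "args_functor [] t =
     const_functor (endo_cat (power_cat C S)) (endo_cat (power_cat C S))
       (comp_functor (power_cat C S) (const_functor (power_cat C S) C T) (hat_functor t))"
| "args_functor [a] t = arg_functor a t"
| "args_functor (a # b # l) t =
     prod_functor (endo_cat (power_cat C S)) (endo_cat (power_cat C S))
       (pointwise_prods (power_cat C S) (power_cat C S) (pointwise_prods (discrete S) C P))
       (arg_functor a t) (args_functor (b # l) t)"

definition signature_functor where
  "signature_functor I ar =
     coprod_functor (endo_cat (power_cat C S)) (endo_cat (power_cat C S))
       (pointwise_coprods (power_cat C S) (power_cat C S) (pointwise_coprods (discrete S) C K))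
       I (\<lambda>i. args_functor (fst (ar i)) (snd (ar i)))"

definition id_plus_functor where
  "id_plus_functor H =
     sum_functor (endo_cat (power_cat C S)) (endo_cat (power_cat C S))
       (pointwise_coprods (power_cat C S) (power_cat C S) (pointwise_coprods (discrete S) C Kbin))
       (const_functor (endo_cat (power_cat C S)) (endo_cat (power_cat C S)) (id_functor (power_cat C S))) H"

end

lemma option_functor_apply:
  assumes "\<xi> \<in> Ob (power_cat C S)" "t \<in> S"
  shows "FOb (FOb (option_functor C T K Kbin S s) \<xi>) t =
    Coprod Kbin UNIV (case_bool (Coprod K (eq_proofs s t) (\<lambda>_ \<in> eq_proofs s t. T)) (FOb \<xi> t))"
proof -
  let ?D = "power_cat C S"
  have "(\<lambda>j. FOb (FOb (case_bool (const_functor ?D ?D (hat_obj C K S s T)) (id_functor ?D) j) \<xi>) t) =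
      case_bool (Coprod K (eq_proofs s t) (\<lambda>_ \<in> eq_proofs s t. T)) (FOb \<xi> t)"
    using assms
    by (auto simp: fun_eq_iff hat_obj_def Let_def const_functor_def id_functor_def split: bool.split)
  moreover have "t \<in> Ob (discrete S)"
    using assms(2) by (simp add: discrete_def)
  ultimately show ?thesis
    using assms(1)
    by (simp add: option_functor_def sum_functor_def coprod_functor_def pointwise_coprods_def restrict_def)
qed

lemma signature_functor_apply:
  assumes "X \<in> Ob (endo_cat (power_cat C S))" "\<xi> \<in> Ob (power_cat C S)" "t \<in> S"
  shows "FOb (FOb (FOb (signature_functor C T P K Kbin S I ar) X) \<xi>) t =
    Coprod K I (\<lambda>i \<in> I. FOb (FOb (FOb (args_functor C T P K Kbin S (fst (ar i)) (snd (ar i))) X) \<xi>) t)"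
  using assms
  by (simp add: signature_functor_def coprod_functor_def pointwise_coprods_def discrete_def
      cong: restrict_cong)

end

(* Limits of cochains in a functor category are computed pointwise, and so are products and
   coproducts; hence a coproduct of continuous functors into a functor category is continuous as
   soon as coproducts of the given shape preserve omega-limits in the base category, which is what
   distributivity says. The summands of H are built from precompositions, evaluations, the functors
   c |-> coprod_(s = t) c (continuous by distributivity over subsingletons) and binary products.
   The final coalgebra is the limit of the terminal cochain. *)

theory Submission
  imports Defs
begin

section \<open>Functor categories\<close>

text \<open>\<open>omega_continuous\<close> asks that every limit cone be sent to a limit cone, and
  nothing is said about the components of a limit in a functor category. So two directions are
  needed: a componentwise limit is a limit, and every limit is componentwise. The second is obtained
  by constructing one componentwise limit and comparing, which is where existence of limits in the
  target enters. Distributivity speaks of a canonical arrow between arbitrary coproducts and limits.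
  It is turned into a statement about chosen coproducts of limiting cones; in that form it lifts
  from B to [A, B], and two liftings lead from C through C^S to [C^S, C^S]. The option functors
  occur only to the left of X. Precomposition with any functor is continuous, so for them
  functoriality suffices. The summand Id of Id + H and the functor of an empty argument list are
  constant in X; they are continuous because the shape of a cochain is connected, so a constant
  cochain of identities has its value as limit.\<close>

lemma homD:
  assumes "f \<in> hom C a b"
  shows "f \<in> Arr C" "Dom C f = a" "Cod C f = b"
  using assms by (auto simp: hom_def)

lemma Arr_hom: "f \<in> Arr C \<Longrightarrow> f \<in> hom C (Dom C f) (Cod C f)"
  by (simp add: hom_def)

lemma (in category) hom_ob:
  assumes "f \<in> hom C a b"
  shows "a \<in> Ob C" "b \<in> Ob C"
  using assms dom_in cod_in by (auto simp: hom_def)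

text \<open>\<open>is_functor\<close> quantifies over arrows and compares \<open>Dom\<close> and
  \<open>Cod\<close>; with named source and target the obligations fit the hom-based axioms of
  \<open>category\<close>.\<close>

lemma is_functorI:
  assumes "FOb F \<in> extensional (Ob A)" "FArr F \<in> extensional (Arr A)"
    and "\<And>a. a \<in> Ob A \<Longrightarrow> FOb F a \<in> Ob B"
    and "\<And>f a b. f \<in> hom A a b \<Longrightarrow> FArr F f \<in> hom B (FOb F a) (FOb F b)"
    and "\<And>a. a \<in> Ob A \<Longrightarrow> FArr F (Ident A a) = Ident B (FOb F a)"
    and "\<And>f g a b c. f \<in> hom A a b \<Longrightarrow> g \<in> hom A b c \<Longrightarrow>
      FArr F (f \<cdot>\<^bsub>A\<^esub> g) = FArr F f \<cdot>\<^bsub>B\<^esub> FArr F g"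
  shows "is_functor A B F"
  unfolding is_functor_def
proof (intro conjI ballI impI)
  show "FOb F \<in> Ob A \<rightarrow>\<^sub>E Ob B"
    using assms(1,3) by (auto simp: PiE_def)
  show "FArr F (f \<cdot>\<^bsub>A\<^esub> g) = FArr F f \<cdot>\<^bsub>B\<^esub> FArr F g"
    if "f \<in> Arr A" "g \<in> Arr A" "Cod A f = Dom A g" for f g
    using that by (intro assms(6)[OF Arr_hom]) (simp_all add: hom_def)
qed (simp_all add: assms Arr_hom)

lemma is_functorD:
  assumes "is_functor A B F"
  shows functor_ob: "a \<in> Ob A \<Longrightarrow> FOb F a \<in> Ob B"
    and functor_hom: "f \<in> hom A a b \<Longrightarrow> FArr F f \<in> hom B (FOb F a) (FOb F b)"
    and functor_id: "a \<in> Ob A \<Longrightarrow> FArr F (Ident A a) = Ident B (FOb F a)"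
    and functor_comp: "f \<in> hom A a b \<Longrightarrow> g \<in> hom A b c \<Longrightarrow>
      FArr F (f \<cdot>\<^bsub>A\<^esub> g) = FArr F f \<cdot>\<^bsub>B\<^esub> FArr F g"
  using assms by (auto simp: is_functor_def PiE_def Pi_def hom_def)

lemma Ob_functor_cat [simp]: "F \<in> Ob (functor_cat A B) \<longleftrightarrow> is_functor A B F"
  by (simp add: functor_cat_def)

lemma hom_functor_cat:
  "\<alpha> \<in> hom (functor_cat A B) F G \<longleftrightarrow> is_ntrans A B \<alpha> \<and> NDom \<alpha> = F \<and> NCod \<alpha> = G"
  by (simp add: functor_cat_def hom_def)

text \<open>Transformations are built below as records of this shape: the restriction to
  \<open>Ob A\<close> supplies the extensionality that \<open>is_ntrans\<close> demands, which
  leaves typing and naturality.\<close>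

lemma homI_functor_cat:
  assumes "category A" "is_functor A B F" "is_functor A B G"
    and "\<And>a. a \<in> Ob A \<Longrightarrow> \<eta> a \<in> hom B (FOb F a) (FOb G a)"
    and "\<And>f a b. f \<in> hom A a b \<Longrightarrow> FArr F f \<cdot>\<^bsub>B\<^esub> \<eta> b = \<eta> a \<cdot>\<^bsub>B\<^esub> FArr G f"
  shows "\<lparr> NDom = F, NCod = G, NMap = (\<lambda>a \<in> Ob A. \<eta> a) \<rparr> \<in> hom (functor_cat A B) F G"
  unfolding hom_functor_cat is_ntrans_def
  using assms by (auto simp: Arr_hom category.dom_in category.cod_in)

lemma ntransD:
  assumes "\<alpha> \<in> hom (functor_cat A B) F G"
  shows ntrans_dom: "is_functor A B F"
    and ntrans_cod: "is_functor A B G"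
    and ntrans_component: "a \<in> Ob A \<Longrightarrow> NMap \<alpha> a \<in> hom B (FOb F a) (FOb G a)"
    and ntrans_natural: "f \<in> hom A a b \<Longrightarrow>
      FArr F f \<cdot>\<^bsub>B\<^esub> NMap \<alpha> b = NMap \<alpha> a \<cdot>\<^bsub>B\<^esub> FArr G f"
  using assms by (auto simp: hom_functor_cat is_ntrans_def) (auto simp: hom_def)

text \<open>Both transformations are \<open>undefined\<close> off \<open>Ob A\<close>, and the
  hom-set fixes their \<open>NDom\<close> and \<open>NCod\<close>, so the components on
  \<open>Ob A\<close> decide.\<close>

lemma ntrans_ext:
  assumes "\<alpha> \<in> hom (functor_cat A B) F G" "\<beta> \<in> hom (functor_cat A B) F G"
    and "\<And>a. a \<in> Ob A \<Longrightarrow> NMap \<alpha> a = NMap \<beta> a"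
  shows "\<alpha> = \<beta>"
proof -
  have "NMap \<alpha> = NMap \<beta>"
    using assms by (intro extensionalityI[where A = "Ob A"]) (auto simp: hom_functor_cat is_ntrans_def)
  then show ?thesis
    using assms by (simp add: hom_functor_cat)
qed

lemma NMap_comp [simp]:
  "a \<in> Ob A \<Longrightarrow> NMap (\<alpha> \<cdot>\<^bsub>functor_cat A B\<^esub> \<beta>) a = NMap \<alpha> a \<cdot>\<^bsub>B\<^esub> NMap \<beta> a"
  by (simp add: functor_cat_def)

lemma NMap_Ident [simp]:
  "a \<in> Ob A \<Longrightarrow> NMap (Ident (functor_cat A B) F) a = Ident B (FOb F a)"
  by (simp add: functor_cat_def)

lemma Ident_hom_functor_cat:
  assumes "category A" "category B" "is_functor A B F"
  shows "Ident (functor_cat A B) F \<in> hom (functor_cat A B) F F"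
proof -
  have "\<lparr> NDom = F, NCod = F, NMap = (\<lambda>a \<in> Ob A. Ident B (FOb F a)) \<rparr> \<in> hom (functor_cat A B) F F"
  proof (rule homI_functor_cat[OF assms(1,3,3)])
    fix f a b assume "f \<in> hom A a b"
    note f = functor_hom[OF assms(3) this]
    show "FArr F f \<cdot>\<^bsub>B\<^esub> Ident B (FOb F b) = Ident B (FOb F a) \<cdot>\<^bsub>B\<^esub> FArr F f"
      using category.comp_id[OF assms(2) f] category.id_comp[OF assms(2) f] by simp
  qed (rule category.id_hom[OF assms(2) functor_ob[OF assms(3)]])
  then show ?thesis by (simp add: functor_cat_def)
qed

lemma Comp_hom_functor_cat:
  assumes "category A" "category B"
    and \<alpha>: "\<alpha> \<in> hom (functor_cat A B) F G" and \<beta>: "\<beta> \<in> hom (functor_cat A B) G H"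
  shows "\<alpha> \<cdot>\<^bsub>functor_cat A B\<^esub> \<beta> \<in> hom (functor_cat A B) F H"
proof -
  interpret B: category B by fact
  have "\<lparr> NDom = F, NCod = H, NMap = (\<lambda>a \<in> Ob A. NMap \<alpha> a \<cdot>\<^bsub>B\<^esub> NMap \<beta> a) \<rparr>
    \<in> hom (functor_cat A B) F H"
  proof (rule homI_functor_cat[OF assms(1) ntrans_dom[OF \<alpha>] ntrans_cod[OF \<beta>]])
    fix a assume "a \<in> Ob A"
    then show "NMap \<alpha> a \<cdot>\<^bsub>B\<^esub> NMap \<beta> a \<in> hom B (FOb F a) (FOb H a)"
      using ntrans_component \<alpha> \<beta> B.comp_hom by metis
  next
    fix f a b assume f: "f \<in> hom A a b"
    then have ab: "a \<in> Ob A" "b \<in> Ob A"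
      using assms(1) category.hom_ob by metis+
    note fs = functor_hom[OF ntrans_dom[OF \<alpha>] f] functor_hom[OF ntrans_cod[OF \<alpha>] f]
      functor_hom[OF ntrans_cod[OF \<beta>] f]
    note cs = ntrans_component[OF \<alpha>] ntrans_component[OF \<beta>]
    \<comment> \<open>The naturality squares of \<alpha> and \<beta> are pasted, each moving
      \<open>f\<close> one place to the right.\<close>
    have "FArr F f \<cdot>\<^bsub>B\<^esub> (NMap \<alpha> b \<cdot>\<^bsub>B\<^esub> NMap \<beta> b) = NMap \<alpha> a \<cdot>\<^bsub>B\<^esub> FArr G f \<cdot>\<^bsub>B\<^esub> NMap \<beta> b"
      using B.comp_assoc[OF fs(1) cs(1,2)] ntrans_natural[OF \<alpha> f] ab by simp
    also have "\<dots> = NMap \<alpha> a \<cdot>\<^bsub>B\<^esub> (NMap \<beta> a \<cdot>\<^bsub>B\<^esub> FArr H f)"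
      using B.comp_assoc[OF cs(1) fs(2) cs(2)] ntrans_natural[OF \<beta> f] ab by simp
    also have "\<dots> = NMap \<alpha> a \<cdot>\<^bsub>B\<^esub> NMap \<beta> a \<cdot>\<^bsub>B\<^esub> FArr H f"
      using B.comp_assoc[OF cs(1,2) fs(3)] ab by simp
    finally show "FArr F f \<cdot>\<^bsub>B\<^esub> (NMap \<alpha> b \<cdot>\<^bsub>B\<^esub> NMap \<beta> b) =
      NMap \<alpha> a \<cdot>\<^bsub>B\<^esub> NMap \<beta> a \<cdot>\<^bsub>B\<^esub> FArr H f" .
  qed
  then show ?thesis
    using \<alpha> \<beta> by (simp add: functor_cat_def hom_def)
qed

lemma category_functor_cat:
  assumes "category A" "category B"
  shows "category (functor_cat A B)"
proof -
  interpret B: category B by fact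
  show ?thesis
  proof
    show "Dom (functor_cat A B) f \<in> Ob (functor_cat A B)" "Cod (functor_cat A B) f \<in> Ob (functor_cat A B)"
      if "f \<in> Arr (functor_cat A B)" for f
      using that by (simp_all add: functor_cat_def is_ntrans_def)
    show "Ident (functor_cat A B) F \<in> hom (functor_cat A B) F F" if "F \<in> Ob (functor_cat A B)" for F
      using that Ident_hom_functor_cat[OF assms] by simp
    show "\<alpha> \<cdot>\<^bsub>functor_cat A B\<^esub> \<beta> \<in> hom (functor_cat A B) F H"
      if "\<alpha> \<in> hom (functor_cat A B) F G" "\<beta> \<in> hom (functor_cat A B) G H" for \<alpha> \<beta> F G H
      using that by (rule Comp_hom_functor_cat[OF assms])
    show "Ident (functor_cat A B) F \<cdot>\<^bsub>functor_cat A B\<^esub> \<alpha> = \<alpha>"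
      if "\<alpha> \<in> hom (functor_cat A B) F G" for \<alpha> F G
      using that
      by (intro ntrans_ext[OF Comp_hom_functor_cat[OF assms Ident_hom_functor_cat[OF assms ntrans_dom[OF that]] that] that])
        (simp add: B.id_comp[OF ntrans_component[OF that]])
    show "\<alpha> \<cdot>\<^bsub>functor_cat A B\<^esub> Ident (functor_cat A B) G = \<alpha>"
      if "\<alpha> \<in> hom (functor_cat A B) F G" for \<alpha> F G
      using that
      by (intro ntrans_ext[OF Comp_hom_functor_cat[OF assms that Ident_hom_functor_cat[OF assms ntrans_cod[OF that]]] that])
        (simp add: B.comp_id[OF ntrans_component[OF that]])
    show "\<alpha> \<cdot>\<^bsub>functor_cat A B\<^esub> \<beta> \<cdot>\<^bsub>functor_cat A B\<^esub> \<gamma> = \<alpha> \<cdot>\<^bsub>functor_cat A B\<^esub> (\<beta> \<cdot>\<^bsub>functor_cat A B\<^esub> \<gamma>)"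
      if "\<alpha> \<in> hom (functor_cat A B) F G" "\<beta> \<in> hom (functor_cat A B) G H"
        "\<gamma> \<in> hom (functor_cat A B) H L" for \<alpha> \<beta> \<gamma> F G H L
      by (rule ntrans_ext[where A = A and B = B and F = F and G = L])
        (use that in \<open>auto intro!: Comp_hom_functor_cat[OF assms] B.comp_assoc intro: ntrans_component\<close>)
  qed
qed

lemma category_discrete: "category (discrete S)"
  by standard (auto simp: discrete_def hom_def)

lemma Ob_discrete [simp]: "Ob (discrete S) = S"
  by (simp add: discrete_def)

lemma hom_discrete: "f \<in> hom (discrete S) a b \<longleftrightarrow> f = a \<and> f = b \<and> f \<in> S"
  by (auto simp: discrete_def hom_def)

lemma category_power_cat: "category C \<Longrightarrow> category (power_cat C S)"
  by (simp add: category_functor_cat category_discrete)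


subsection \<open>Basic functors\<close>

lemma const_functor_simps [simp]:
  "a \<in> Ob A \<Longrightarrow> FOb (const_functor A B b) a = b"
  "f \<in> hom A x y \<Longrightarrow> FArr (const_functor A B b) f = Ident B b"
  by (auto simp: const_functor_def hom_def)

lemma id_functor_simps [simp]:
  "a \<in> Ob A \<Longrightarrow> FOb (id_functor A) a = a"
  "f \<in> hom A x y \<Longrightarrow> FArr (id_functor A) f = f"
  by (auto simp: id_functor_def hom_def)

lemma comp_functor_simps [simp]:
  "a \<in> Ob A \<Longrightarrow> FOb (comp_functor A F G) a = FOb G (FOb F a)"
  "f \<in> hom A x y \<Longrightarrow> FArr (comp_functor A F G) f = FArr G (FArr F f)"
  by (auto simp: comp_functor_def hom_def)

lemma is_functor_const:
  assumes "category A" "category B" "b \<in> Ob B"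
  shows "is_functor A B (const_functor A B b)"
proof (rule is_functorI)
  interpret A: category A by fact
  interpret B: category B by fact
  note b = B.id_hom[OF assms(3)]
  show "FArr (const_functor A B b) f \<in> hom B (FOb (const_functor A B b) x) (FOb (const_functor A B b) y)"
    if "f \<in> hom A x y" for f x y
    using that A.hom_ob[OF that] b by simp
  show "FArr (const_functor A B b) (Ident A x) = Ident B (FOb (const_functor A B b) x)"
    if "x \<in> Ob A" for x
    using that A.id_hom[OF that] by simp
  show "FArr (const_functor A B b) (f \<cdot>\<^bsub>A\<^esub> g) =
      FArr (const_functor A B b) f \<cdot>\<^bsub>B\<^esub> FArr (const_functor A B b) g"
    if "f \<in> hom A x y" "g \<in> hom A y z" for f g x y z
    using that A.comp_hom[OF that] B.comp_id[OF b] by simp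
qed (auto simp: const_functor_def assms(3))

lemma is_functor_id:
  assumes "category A"
  shows "is_functor A A (id_functor A)"
proof (rule is_functorI)
  interpret A: category A by fact
  show "FArr (id_functor A) f \<in> hom A (FOb (id_functor A) x) (FOb (id_functor A) y)"
    if "f \<in> hom A x y" for f x y
    using that A.hom_ob[OF that] by simp
  show "FArr (id_functor A) (Ident A x) = Ident A (FOb (id_functor A) x)" if "x \<in> Ob A" for x
    using that A.id_hom[OF that] by simp
  show "FArr (id_functor A) (f \<cdot>\<^bsub>A\<^esub> g) = FArr (id_functor A) f \<cdot>\<^bsub>A\<^esub> FArr (id_functor A) g"
    if "f \<in> hom A x y" "g \<in> hom A y z" for f g x y z
    using that A.comp_hom[OF that] by simp
qed (auto simp: id_functor_def)

lemma is_functor_comp: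
  assumes "category A" "is_functor A B F" "is_functor B E G"
  shows "is_functor A E (comp_functor A F G)"
proof (rule is_functorI)
  interpret A: category A by fact
  note F = is_functorD[OF assms(2)] and G = is_functorD[OF assms(3)]
  show "FOb (comp_functor A F G) x \<in> Ob E" if "x \<in> Ob A" for x
    using that F G by simp
  show "FArr (comp_functor A F G) f \<in> hom E (FOb (comp_functor A F G) x) (FOb (comp_functor A F G) y)"
    if "f \<in> hom A x y" for f x y
    using that A.hom_ob[OF that] F(2) G(2) by simp
  show "FArr (comp_functor A F G) (Ident A x) = Ident E (FOb (comp_functor A F G) x)"
    if "x \<in> Ob A" for x
    using that A.id_hom[OF that] F G by simp
  show "FArr (comp_functor A F G) (f \<cdot>\<^bsub>A\<^esub> g) =
      FArr (comp_functor A F G) f \<cdot>\<^bsub>E\<^esub> FArr (comp_functor A F G) g"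
    if "f \<in> hom A x y" "g \<in> hom A y z" for f g x y z
    using that A.comp_hom[OF that] F(2,4) G(4)[OF F(2) F(2)] by simp
qed (auto simp: comp_functor_def)

section \<open>Whiskering with a functor on either side\<close>

lemma whisker_functor_simps:
  "is_functor B B' X \<Longrightarrow> FOb (whisker_functor A B B' K L) X = comp_functor A K (comp_functor B X L)"
  "\<alpha> \<in> hom (functor_cat B B') X Y \<Longrightarrow> FArr (whisker_functor A B B' K L) \<alpha> =
    \<lparr> NDom = comp_functor A K (comp_functor B X L), NCod = comp_functor A K (comp_functor B Y L),
      NMap = (\<lambda>a \<in> Ob A. FArr L (NMap \<alpha> (FOb K a))) \<rparr>"
proof -
  show "FOb (whisker_functor A B B' K L) X = comp_functor A K (comp_functor B X L)" if "is_functor B B' X"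
    using that by (simp add: whisker_functor_def Let_def)
  assume \<alpha>: "\<alpha> \<in> hom (functor_cat B B') X Y"
  then show "FArr (whisker_functor A B B' K L) \<alpha> =
    \<lparr> NDom = comp_functor A K (comp_functor B X L), NCod = comp_functor A K (comp_functor B Y L),
      NMap = (\<lambda>a \<in> Ob A. FArr L (NMap \<alpha> (FOb K a))) \<rparr>"
    using homD(1)[OF \<alpha>] by (simp add: whisker_functor_def Let_def hom_functor_cat)
qed

text \<open>Whiskered transformations have components \<open>FArr L\<close> of components at
  \<open>FOb K a\<close>, so identities and composites are preserved because \<open>L\<close>
  preserves them there.\<close>

lemma is_functor_whisker:
  assumes "category A" "category B" "category B'" "category E"
    and K: "is_functor A B K" and L: "is_functor B' E L"
  shows "is_functor (functor_cat B B') (functor_cat A E) (whisker_functor A B B' K L)"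
proof (rule is_functorI)
  interpret A: category A by fact
  interpret B: category B by fact
  interpret X: category "functor_cat B B'" by (rule category_functor_cat) fact+
  interpret Y: category "functor_cat A E" by (rule category_functor_cat) fact+
  let ?W = "whisker_functor A B B' K L"
  have W: "is_functor A E (comp_functor A K (comp_functor B X L))" if "is_functor B B' X" for X
    using that assms by (intro is_functor_comp[where B = B] is_functor_comp[where B = B'])
  then show ob: "FOb ?W X \<in> Ob (functor_cat A E)" if "X \<in> Ob (functor_cat B B')" for X
    using that by (simp add: whisker_functor_simps)
  show hom: "FArr ?W \<alpha> \<in> hom (functor_cat A E) (FOb ?W X) (FOb ?W Y)"
    if \<alpha>: "\<alpha> \<in> hom (functor_cat B B') X Y" for \<alpha> X Y
  proof -
    note XY = ntrans_dom[OF \<alpha>] ntrans_cod[OF \<alpha>]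
    show ?thesis
      unfolding whisker_functor_simps(1)[OF XY(1)] whisker_functor_simps(1)[OF XY(2)] whisker_functor_simps(2)[OF \<alpha>]
    proof (rule homI_functor_cat[OF assms(1) W W])
      fix a assume a: "a \<in> Ob A"
      then show "FArr L (NMap \<alpha> (FOb K a)) \<in> hom E (FOb (comp_functor A K (comp_functor B X L)) a)
          (FOb (comp_functor A K (comp_functor B Y L)) a)"
        using functor_ob[OF K a] functor_hom[OF L ntrans_component[OF \<alpha>]] by simp
    next
      fix f a b assume f: "f \<in> hom A a b"
      then have ab: "a \<in> Ob A" "b \<in> Ob A" by (auto dest: A.hom_ob)
      note Kf = functor_hom[OF K f]
      \<comment> \<open>This is \<open>L\<close> applied to the naturality square of \<alpha> at
        \<open>FArr K f\<close>.\<close>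
      have "FArr L (FArr X (FArr K f)) \<cdot>\<^bsub>E\<^esub> FArr L (NMap \<alpha> (FOb K b)) =
          FArr L (NMap \<alpha> (FOb K a)) \<cdot>\<^bsub>E\<^esub> FArr L (FArr Y (FArr K f))"
        using functor_comp[OF L functor_hom[OF XY(1) Kf] ntrans_component[OF \<alpha> functor_ob[OF K ab(2)]]]
          functor_comp[OF L ntrans_component[OF \<alpha> functor_ob[OF K ab(1)]] functor_hom[OF XY(2) Kf]]
          ntrans_natural[OF \<alpha> Kf] by simp
      then show "FArr (comp_functor A K (comp_functor B X L)) f \<cdot>\<^bsub>E\<^esub> FArr L (NMap \<alpha> (FOb K b)) =
          FArr L (NMap \<alpha> (FOb K a)) \<cdot>\<^bsub>E\<^esub> FArr (comp_functor A K (comp_functor B Y L)) f"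
        using f Kf by simp
    qed (use XY in auto)
  qed
  show "FArr ?W (Ident (functor_cat B B') X) = Ident (functor_cat A E) (FOb ?W X)"
    if X: "X \<in> Ob (functor_cat B B')" for X
  proof (rule ntrans_ext[OF hom[OF X.id_hom[OF X]] Y.id_hom[OF ob[OF X]]])
    fix a assume "a \<in> Ob A"
    then show "NMap (FArr ?W (Ident (functor_cat B B') X)) a = NMap (Ident (functor_cat A E) (FOb ?W X)) a"
      using X functor_ob[OF K, of a] functor_id[OF L functor_ob[of B B' X]]
      by (simp add: whisker_functor_simps(2)[OF X.id_hom[OF X]] whisker_functor_simps(1))
  qed
  show "FArr ?W (\<alpha> \<cdot>\<^bsub>functor_cat B B'\<^esub> \<beta>) = FArr ?W \<alpha> \<cdot>\<^bsub>functor_cat A E\<^esub> FArr ?W \<beta>"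
    if \<alpha>: "\<alpha> \<in> hom (functor_cat B B') X Y" and \<beta>: "\<beta> \<in> hom (functor_cat B B') Y Z" for \<alpha> \<beta> X Y Z
  proof (rule ntrans_ext[OF hom[OF X.comp_hom[OF \<alpha> \<beta>]] Y.comp_hom[OF hom[OF \<alpha>] hom[OF \<beta>]]])
    fix a assume "a \<in> Ob A"
    then show "NMap (FArr ?W (\<alpha> \<cdot>\<^bsub>functor_cat B B'\<^esub> \<beta>)) a =
        NMap (FArr ?W \<alpha> \<cdot>\<^bsub>functor_cat A E\<^esub> FArr ?W \<beta>) a"
      using functor_ob[OF K, of a] functor_comp[OF L ntrans_component[OF \<alpha>] ntrans_component[OF \<beta>]]
      by (simp add: whisker_functor_simps(2)[OF X.comp_hom[OF \<alpha> \<beta>]] whisker_functor_simps(2)[OF \<alpha>] whisker_functor_simps(2)[OF \<beta>])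
  qed
qed (simp_all add: whisker_functor_def Let_def)


section \<open>Coproducts\<close>

text \<open>The index set is a parameter, since coproducts over \<open>eq_proofs s t\<close>, over
  the index set of the signature and over \<open>bool\<close> all occur, the last with an index type
  of its own.\<close>

locale category_with_coproducts = category C for C :: "('o, 'm) cat" (structure) +
  fixes K :: "('j, 'o, 'm) coprods" and J :: "'j set"
  assumes coproducts: "chosen_coproducts C K J"
begin

text \<open>A choice of coproducts is guaranteed for extensional families, so an arbitrary family
  enters through \<open>restrict\<close>; hence the form \<open>restrict x J\<close> throughout this
  locale.\<close>

lemma is_coproduct_restrict:
  assumes "\<forall>j\<in>J. x j \<in> Ob C"
  shows "is_coproduct C J (restrict x J) (Coprod K J (restrict x J)) (Inj K J (restrict x J))"
  using assms coproducts by (simp add: chosen_coproducts_def)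

lemma coprod_ob: "\<forall>j\<in>J. x j \<in> Ob C \<Longrightarrow> Coprod K J (restrict x J) \<in> Ob C"
  using is_coproduct_restrict[of x] by (simp add: is_coproduct_def)

lemma inj_hom:
  assumes "\<forall>j\<in>J. x j \<in> Ob C" "j \<in> J"
  shows "Inj K J (restrict x J) j \<in> hom C (x j) (Coprod K J (restrict x J))"
  using is_coproduct_restrict[OF assms(1)] assms(2) by (simp add: is_coproduct_def)

lemma coprod_desc:
  assumes "\<forall>j\<in>J. x j \<in> Ob C" "d \<in> Ob C" "\<forall>j\<in>J. f j \<in> hom C (x j) d"
  shows "\<exists>!m. m \<in> hom C (Coprod K J (restrict x J)) d \<and> (\<forall>j\<in>J. Inj K J (restrict x J) j \<cdot> m = f j)"
proof -
  have "\<forall>d\<in>Ob C. \<forall>f. (\<forall>j\<in>J. f j \<in> hom C (x j) d) \<longrightarrow>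
      (\<exists>!m. m \<in> hom C (Coprod K J (restrict x J)) d \<and> (\<forall>j\<in>J. Inj K J (restrict x J) j \<cdot> m = f j))"
    using is_coproduct_restrict[OF assms(1)] unfolding is_coproduct_def by simp
  then show ?thesis using assms(2,3) by blast
qed

text \<open>Both arrows solve the same universal problem, so the injections are jointly epic.
  Naturality and uniqueness of arrows out of a coproduct are reduced to this.\<close>

lemma coprod_eqI:
  assumes x: "\<forall>j\<in>J. x j \<in> Ob C"
    and m: "m \<in> hom C (Coprod K J (restrict x J)) d" "m' \<in> hom C (Coprod K J (restrict x J)) d"
    and "\<And>j. j \<in> J \<Longrightarrow> Inj K J (restrict x J) j \<cdot> m = Inj K J (restrict x J) j \<cdot> m'"
  shows "m = m'"
proof -
  have "\<exists>!n. n \<in> hom C (Coprod K J (restrict x J)) d \<and>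
      (\<forall>j\<in>J. Inj K J (restrict x J) j \<cdot> n = Inj K J (restrict x J) j \<cdot> m)"
    using comp_hom[OF inj_hom[OF x] m(1)] by (intro coprod_desc[OF x hom_ob(2)[OF m(1)]]) simp
  then show ?thesis using assms(4) m by metis
qed

lemma hom_family_ob:
  assumes "\<forall>j\<in>J. f j \<in> hom C (x j) (y j)"
  shows "\<forall>j\<in>J. x j \<in> Ob C" "\<forall>j\<in>J. y j \<in> Ob C"
  using hom_ob[OF bspec[OF assms]] by simp_all

text \<open>Justifies the definite description behind \<open>coprod_map\<close>.\<close>

lemma coprod_map_unique:
  assumes f: "\<forall>j\<in>J. f j \<in> hom C (x j) (y j)"
  shows "\<exists>!m. m \<in> hom C (Coprod K J (restrict x J)) (Coprod K J (restrict y J)) \<and>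
    (\<forall>j\<in>J. Inj K J (restrict x J) j \<cdot> m = f j \<cdot> Inj K J (restrict y J) j)"
proof (rule coprod_desc[OF hom_family_ob(1)[OF f] coprod_ob[OF hom_family_ob(2)[OF f]]])
  show "\<forall>j\<in>J. f j \<cdot> Inj K J (restrict y J) j \<in> hom C (x j) (Coprod K J (restrict y J))"
    using comp_hom[OF bspec[OF f] inj_hom[OF hom_family_ob(2)[OF f]]] by simp
qed

text \<open>\<open>coprod_map\<close> reads the source and target families off \<open>f\<close>; any
  \<open>x\<close> and \<open>y\<close> that type \<open>f\<close> on \<open>J\<close> agree with
  them after restriction.\<close>

lemma coprod_map_eq:
  assumes f: "\<forall>j\<in>J. f j \<in> hom C (x j) (y j)"
  shows "coprod_map C K J f =
    (THE m. m \<in> hom C (Coprod K J (restrict x J)) (Coprod K J (restrict y J)) \<and>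
    (\<forall>j\<in>J. Inj K J (restrict x J) j \<cdot> m = f j \<cdot> Inj K J (restrict y J) j))"
proof -
  have "(\<lambda>j\<in>J. Dom C (f j)) = restrict x J" "(\<lambda>j\<in>J. Cod C (f j)) = restrict y J"
    using homD[OF bspec[OF f]] by (auto intro!: restrict_ext)
  then show ?thesis by (simp add: coprod_map_def Let_def)
qed

lemma coprod_map:
  assumes f: "\<forall>j\<in>J. f j \<in> hom C (x j) (y j)"
  shows coprod_map_hom:
      "coprod_map C K J f \<in> hom C (Coprod K J (restrict x J)) (Coprod K J (restrict y J))"
    and inj_coprod_map:
      "j \<in> J \<Longrightarrow> Inj K J (restrict x J) j \<cdot> coprod_map C K J f = f j \<cdot> Inj K J (restrict y J) j"
  using theI'[OF coprod_map_unique[OF f]] coprod_map_eq[OF f] by simp_all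

lemma coprod_map_eqI:
  assumes f: "\<forall>j\<in>J. f j \<in> hom C (x j) (y j)"
    and "m \<in> hom C (Coprod K J (restrict x J)) (Coprod K J (restrict y J))"
    and "\<And>j. j \<in> J \<Longrightarrow> Inj K J (restrict x J) j \<cdot> m = f j \<cdot> Inj K J (restrict y J) j"
  shows "coprod_map C K J f = m"
  unfolding coprod_map_eq[OF f]
  by (rule the1_equality[OF coprod_map_unique[OF f]]) (use assms in auto)

lemma coprod_map_Ident:
  assumes x: "\<forall>j\<in>J. x j \<in> Ob C"
  shows "coprod_map C K J (\<lambda>j. Ident C (x j)) = Ident C (Coprod K J (restrict x J))"
  by (rule coprod_map_eqI[where x = x and y = x])
    (auto simp: x comp_id[OF inj_hom[OF x]] id_comp[OF inj_hom[OF x]] intro!: id_hom coprod_ob)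

lemma coprod_map_comp:
  assumes f: "\<forall>j\<in>J. f j \<in> hom C (x j) (y j)" and g: "\<forall>j\<in>J. g j \<in> hom C (y j) (z j)"
  shows "coprod_map C K J (\<lambda>j. f j \<cdot> g j) = coprod_map C K J f \<cdot> coprod_map C K J g"
proof (rule coprod_map_eqI[where x = x and y = z])
  note F = coprod_map[OF f] and G = coprod_map[OF g]
  note obs = hom_family_ob[OF f] hom_family_ob[OF g]
  show "\<forall>j\<in>J. f j \<cdot> g j \<in> hom C (x j) (z j)"
    using comp_hom[OF bspec[OF f] bspec[OF g]] by simp
  show "coprod_map C K J f \<cdot> coprod_map C K J g \<in> hom C (Coprod K J (restrict x J)) (Coprod K J (restrict z J))"
    by (rule comp_hom[OF F(1) G(1)])
  fix j assume j: "j \<in> J"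
  note i = inj_hom[OF obs(1) j] inj_hom[OF obs(2) j] inj_hom[OF obs(4) j]
  note fj = bspec[OF f j] and gj = bspec[OF g j]
  show "Inj K J (restrict x J) j \<cdot> (coprod_map C K J f \<cdot> coprod_map C K J g) =
      f j \<cdot> g j \<cdot> Inj K J (restrict z J) j"
    using comp_assoc[OF i(1) F(1) G(1)] F(2)[OF j] comp_assoc[OF fj i(2) G(1)] G(2)[OF j]
      comp_assoc[OF fj gj i(3)] by simp
qed

end

section \<open>Pointwise coproducts of functors\<close>

lemma coprod_map_cong:
  assumes "\<And>j. j \<in> J \<Longrightarrow> f j = g j"
  shows "coprod_map C K J f = coprod_map C K J g"
  unfolding coprod_map_def Let_def using assms by (simp cong: restrict_cong)

lemma coprod_functor_simps:
  "a \<in> Ob A \<Longrightarrow> FOb (coprod_functor A B K J F) a = Coprod K J (\<lambda>j\<in>J. FOb (F j) a)"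
  "f \<in> hom A x y \<Longrightarrow> FArr (coprod_functor A B K J F) f = coprod_map B K J (\<lambda>j. FArr (F j) f)"
  by (auto simp: coprod_functor_def hom_def)

lemma is_functor_coprod:
  assumes "category A" "category_with_coproducts B K J"
    and F: "\<And>j. j \<in> J \<Longrightarrow> is_functor A B (F j)"
  shows "is_functor A B (coprod_functor A B K J F)"
proof (rule is_functorI)
  interpret A: category A by fact
  interpret B: category_with_coproducts B K J by fact
  show "FOb (coprod_functor A B K J F) a \<in> Ob B" if "a \<in> Ob A" for a
    using that functor_ob[OF F] by (auto simp: coprod_functor_simps intro!: B.coprod_ob)
  show "FArr (coprod_functor A B K J F) f \<in>
      hom B (FOb (coprod_functor A B K J F) a) (FOb (coprod_functor A B K J F) b)"
    if "f \<in> hom A a b" for f a b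
    using that A.hom_ob[OF that] functor_hom[OF F]
    by (auto simp: coprod_functor_simps intro!: B.coprod_map_hom)
  show "FArr (coprod_functor A B K J F) (Ident A a) = Ident B (FOb (coprod_functor A B K J F) a)"
    if a: "a \<in> Ob A" for a
  proof -
    \<comment> \<open>The laws of \<open>F j\<close> are available for \<open>j\<close> in
      \<open>J\<close> only, so they are applied under \<open>coprod_map_cong\<close> instead of
      rewriting the whole family.\<close>
    have "coprod_map B K J (\<lambda>j. FArr (F j) (Ident A a)) = coprod_map B K J (\<lambda>j. Ident B (FOb (F j) a))"
      by (rule coprod_map_cong) (simp add: functor_id[OF F a])
    also have "\<dots> = Ident B (Coprod K J (\<lambda>j\<in>J. FOb (F j) a))"
      by (rule B.coprod_map_Ident) (simp add: functor_ob[OF F a])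
    finally show ?thesis
      by (simp add: coprod_functor_simps(1)[OF a] coprod_functor_simps(2)[OF A.id_hom[OF a]])
  qed
  show "FArr (coprod_functor A B K J F) (f \<cdot>\<^bsub>A\<^esub> g) =
      FArr (coprod_functor A B K J F) f \<cdot>\<^bsub>B\<^esub> FArr (coprod_functor A B K J F) g"
    if f: "f \<in> hom A a b" and g: "g \<in> hom A b c" for f g a b c
  proof -
    have "coprod_map B K J (\<lambda>j. FArr (F j) (f \<cdot>\<^bsub>A\<^esub> g)) =
        coprod_map B K J (\<lambda>j. FArr (F j) f \<cdot>\<^bsub>B\<^esub> FArr (F j) g)"
      by (rule coprod_map_cong) (simp add: functor_comp[OF F f g])
    also have "\<dots> = coprod_map B K J (\<lambda>j. FArr (F j) f) \<cdot>\<^bsub>B\<^esub> coprod_map B K J (\<lambda>j. FArr (F j) g)"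
      by (rule B.coprod_map_comp) (use functor_hom[OF F] f g in auto)
    finally show ?thesis
      by (simp add: coprod_functor_simps(2)[OF f] coprod_functor_simps(2)[OF g]
          coprod_functor_simps(2)[OF A.comp_hom[OF f g]])
  qed
qed (auto simp: coprod_functor_def)

text \<open>The mediating arrows exist object by object in \<open>B\<close>, and the universal
  property there forces them to form a natural family.\<close>

lemma coproducts_functor_cat:
  assumes "category A" "category_with_coproducts B K J"
  shows "category_with_coproducts (functor_cat A B) (pointwise_coprods A B K) J"
proof -
  interpret A: category A by fact
  interpret B: category_with_coproducts B K J by fact
  interpret AB: category "functor_cat A B" by (rule category_functor_cat) unfold_locales
  let ?Q = "coprod_functor A B K J" and ?\<iota> = "Inj (pointwise_coprods A B K) J"
  have "is_coproduct (functor_cat A B) J F (?Q F) (?\<iota> F)" if "F \<in> J \<rightarrow>\<^sub>E Ob (functor_cat A B)" for F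
  proof -
    from that have F: "is_functor A B (F j)" if "j \<in> J" for j using that by auto
    note Fob = functor_ob[OF F]
    note Q = is_functor_coprod[OF assms F]
    have \<iota>_NMap: "NMap (?\<iota> F j) a = Inj K J (\<lambda>j\<in>J. FOb (F j) a) j" if "a \<in> Ob A" for j a
      using that by (simp add: pointwise_coprods_def)
    have \<iota>: "?\<iota> F j \<in> hom (functor_cat A B) (F j) (?Q F)" if j: "j \<in> J" for j
    proof -
      have "\<lparr> NDom = F j, NCod = ?Q F, NMap = (\<lambda>a\<in>Ob A. Inj K J (\<lambda>j\<in>J. FOb (F j) a) j) \<rparr>
        \<in> hom (functor_cat A B) (F j) (?Q F)"
      proof (rule homI_functor_cat[OF assms(1) F[OF j] Q])
        show "Inj K J (\<lambda>j\<in>J. FOb (F j) a) j \<in> hom B (FOb (F j) a) (FOb (?Q F) a)" if "a \<in> Ob A" for a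
          using that Fob j B.inj_hom[of "\<lambda>j. FOb (F j) a" j] by (simp add: coprod_functor_simps)
        show "FArr (F j) f \<cdot>\<^bsub>B\<^esub> Inj K J (\<lambda>j\<in>J. FOb (F j) b) j =
            Inj K J (\<lambda>j\<in>J. FOb (F j) a) j \<cdot>\<^bsub>B\<^esub> FArr (?Q F) f" if "f \<in> hom A a b" for f a b
          unfolding coprod_functor_simps(2)[OF that]
          by (rule B.inj_coprod_map[symmetric]) (use functor_hom[OF F that] j in auto)
      qed
      then show ?thesis by (simp add: pointwise_coprods_def)
    qed
    have "\<exists>!m. m \<in> hom (functor_cat A B) (?Q F) G \<and> (\<forall>j\<in>J. ?\<iota> F j \<cdot>\<^bsub>functor_cat A B\<^esub> m = \<phi> j)"
      if G: "is_functor A B G" and \<phi>: "\<And>j. j \<in> J \<Longrightarrow> \<phi> j \<in> hom (functor_cat A B) (F j) G" for G \<phi>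
    proof (rule ex_ex1I)
      \<comment> \<open>Descend at each object; choice then collects the mediating arrows into
        \<open>\<eta>\<close>.\<close>
      have "\<forall>a\<in>Ob A. \<exists>m. m \<in> hom B (Coprod K J (\<lambda>j\<in>J. FOb (F j) a)) (FOb G a) \<and>
          (\<forall>j\<in>J. Inj K J (\<lambda>j\<in>J. FOb (F j) a) j \<cdot>\<^bsub>B\<^esub> m = NMap (\<phi> j) a)"
        using Fob functor_ob[OF G] ntrans_component[OF \<phi>]
        by (intro ballI ex1_implies_ex B.coprod_desc) simp_all
      from bchoice[OF this] obtain \<eta> where "\<forall>a\<in>Ob A. \<eta> a \<in> hom B (Coprod K J (\<lambda>j\<in>J. FOb (F j) a)) (FOb G a) \<and>
          (\<forall>j\<in>J. Inj K J (\<lambda>j\<in>J. FOb (F j) a) j \<cdot>\<^bsub>B\<^esub> \<eta> a = NMap (\<phi> j) a)"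
        by (rule exE)
      then have \<eta>: "\<And>a. a \<in> Ob A \<Longrightarrow> \<eta> a \<in> hom B (Coprod K J (\<lambda>j\<in>J. FOb (F j) a)) (FOb G a)"
        and \<iota>\<eta>: "\<And>a j. a \<in> Ob A \<Longrightarrow> j \<in> J \<Longrightarrow> Inj K J (\<lambda>j\<in>J. FOb (F j) a) j \<cdot>\<^bsub>B\<^esub> \<eta> a = NMap (\<phi> j) a"
        by simp_all
      let ?m = "\<lparr> NDom = ?Q F, NCod = G, NMap = restrict \<eta> (Ob A) \<rparr>"
      have m: "?m \<in> hom (functor_cat A B) (?Q F) G"
      proof (rule homI_functor_cat[OF assms(1) Q G])
        show "\<eta> a \<in> hom B (FOb (?Q F) a) (FOb G a)" if "a \<in> Ob A" for a
          using \<eta>[OF that] that by (simp add: coprod_functor_simps)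
        show "FArr (?Q F) f \<cdot>\<^bsub>B\<^esub> \<eta> b = \<eta> a \<cdot>\<^bsub>B\<^esub> FArr G f" if f: "f \<in> hom A a b" for f a b
        \<comment> \<open>The naturality square starts at the coproduct at \<open>a\<close>, so it
          is tested on the injections, where it becomes naturality of
          \<open>\<phi> j\<close>.\<close>
        proof (rule B.coprod_eqI[where x = "\<lambda>j. FOb (F j) a"])
          note ab = A.hom_ob[OF f]
          have Ff: "\<forall>j\<in>J. FArr (F j) f \<in> hom B (FOb (F j) a) (FOb (F j) b)"
            using functor_hom[OF F f] by blast
          note Qf = B.coprod_map[OF Ff]
          note Gf = functor_hom[OF G f]
          show "\<forall>j\<in>J. FOb (F j) a \<in> Ob B" using Fob[OF _ ab(1)] by blast
          show "FArr (?Q F) f \<cdot>\<^bsub>B\<^esub> \<eta> b \<in> hom B (Coprod K J (\<lambda>j\<in>J. FOb (F j) a)) (FOb G b)"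
            using B.comp_hom[OF Qf(1) \<eta>[OF ab(2)]] by (simp add: coprod_functor_simps(2)[OF f])
          show "\<eta> a \<cdot>\<^bsub>B\<^esub> FArr G f \<in> hom B (Coprod K J (\<lambda>j\<in>J. FOb (F j) a)) (FOb G b)"
            by (rule B.comp_hom[OF \<eta>[OF ab(1)] Gf])
          fix j assume j: "j \<in> J"
          have i: "Inj K J (\<lambda>j\<in>J. FOb (F j) c) j \<in> hom B (FOb (F j) c) (Coprod K J (\<lambda>j\<in>J. FOb (F j) c))"
            if "c \<in> Ob A" for c
            by (rule B.inj_hom) (use Fob that j in simp_all)
          show "Inj K J (\<lambda>j\<in>J. FOb (F j) a) j \<cdot>\<^bsub>B\<^esub> (FArr (?Q F) f \<cdot>\<^bsub>B\<^esub> \<eta> b) =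
              Inj K J (\<lambda>j\<in>J. FOb (F j) a) j \<cdot>\<^bsub>B\<^esub> (\<eta> a \<cdot>\<^bsub>B\<^esub> FArr G f)"
            unfolding coprod_functor_simps(2)[OF f]
            using B.comp_assoc[OF i[OF ab(1)] Qf(1) \<eta>[OF ab(2)]] Qf(2)[OF j]
              B.comp_assoc[OF bspec[OF Ff j] i[OF ab(2)] \<eta>[OF ab(2)]] B.comp_assoc[OF i[OF ab(1)] \<eta>[OF ab(1)] Gf]
              \<iota>\<eta>[OF ab(1) j] \<iota>\<eta>[OF ab(2) j] ntrans_natural[OF \<phi>[OF j] f] by simp
        qed
      qed
      moreover have "?\<iota> F j \<cdot>\<^bsub>functor_cat A B\<^esub> ?m = \<phi> j" if j: "j \<in> J" for j
        by (rule ntrans_ext[OF AB.comp_hom[OF \<iota>[OF j] m] \<phi>[OF j]]) (simp add: \<iota>_NMap \<iota>\<eta> j)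
      ultimately show "\<exists>m. m \<in> hom (functor_cat A B) (?Q F) G \<and> (\<forall>j\<in>J. ?\<iota> F j \<cdot>\<^bsub>functor_cat A B\<^esub> m = \<phi> j)"
        by blast
    next
      fix m m'
      assume "m \<in> hom (functor_cat A B) (?Q F) G \<and> (\<forall>j\<in>J. ?\<iota> F j \<cdot>\<^bsub>functor_cat A B\<^esub> m = \<phi> j)"
        and "m' \<in> hom (functor_cat A B) (?Q F) G \<and> (\<forall>j\<in>J. ?\<iota> F j \<cdot>\<^bsub>functor_cat A B\<^esub> m' = \<phi> j)"
      then have m: "m \<in> hom (functor_cat A B) (?Q F) G" "m' \<in> hom (functor_cat A B) (?Q F) G"
        and eq: "\<And>j. j \<in> J \<Longrightarrow> ?\<iota> F j \<cdot>\<^bsub>functor_cat A B\<^esub> m = ?\<iota> F j \<cdot>\<^bsub>functor_cat A B\<^esub> m'"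
        by auto
      show "m = m'"
      proof (rule ntrans_ext[OF m])
        fix a assume a: "a \<in> Ob A"
        show "NMap m a = NMap m' a"
        proof (rule B.coprod_eqI[where x = "\<lambda>j. FOb (F j) a"])
          show "Inj K J (\<lambda>j\<in>J. FOb (F j) a) j \<cdot>\<^bsub>B\<^esub> NMap m a = Inj K J (\<lambda>j\<in>J. FOb (F j) a) j \<cdot>\<^bsub>B\<^esub> NMap m' a"
            if "j \<in> J" for j
            using arg_cong[OF eq[OF that], of "\<lambda>\<alpha>. NMap \<alpha> a"] a by (simp add: \<iota>_NMap)
        qed (use Fob a m[THEN ntrans_component] in \<open>auto simp: coprod_functor_simps\<close>)
      qed
    qed
    then show ?thesis
      using Q \<iota> by (simp add: is_coproduct_def)
  qed
  then show ?thesis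
    by unfold_locales (simp add: chosen_coproducts_def pointwise_coprods_def)
qed

text \<open>The component at \<open>a\<close> satisfies the equations that characterise the
  coproduct map of the components. This allows preservation of limits by coproducts to be checked
  one object at a time.\<close>

lemma NMap_coprod_map:
  assumes "category A" "category_with_coproducts B K J"
    and \<phi>: "\<forall>j\<in>J. \<phi> j \<in> hom (functor_cat A B) (F j) (G j)" and a: "a \<in> Ob A"
  shows "NMap (coprod_map (functor_cat A B) (pointwise_coprods A B K) J \<phi>) a =
    coprod_map B K J (\<lambda>j. NMap (\<phi> j) a)"
proof -
  interpret B: category_with_coproducts B K J by fact
  interpret AB: category_with_coproducts "functor_cat A B" "pointwise_coprods A B K" J
    by (rule coproducts_functor_cat) fact+
  have restrict: "(\<lambda>j\<in>J. FOb (restrict H J j) a) = (\<lambda>j\<in>J. FOb (H j) a)" for H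
    by (auto intro!: restrict_ext)
  note m = AB.coprod_map[OF \<phi>]
  have "coprod_map B K J (\<lambda>j. NMap (\<phi> j) a) =
    NMap (coprod_map (functor_cat A B) (pointwise_coprods A B K) J \<phi>) a"
  proof (rule B.coprod_map_eqI[where x = "\<lambda>j. FOb (F j) a" and y = "\<lambda>j. FOb (G j) a"])
    show "\<forall>j\<in>J. NMap (\<phi> j) a \<in> hom B (FOb (F j) a) (FOb (G j) a)"
      using ntrans_component[OF bspec[OF \<phi>] a] by blast
    show "NMap (coprod_map (functor_cat A B) (pointwise_coprods A B K) J \<phi>) a \<in>
      hom B (Coprod K J (\<lambda>j\<in>J. FOb (F j) a)) (Coprod K J (\<lambda>j\<in>J. FOb (G j) a))"
      using ntrans_component[OF m(1) a] a by (simp add: pointwise_coprods_def coprod_functor_simps cong: restrict_cong)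
    show "Inj K J (\<lambda>j\<in>J. FOb (F j) a) j \<cdot>\<^bsub>B\<^esub> NMap (coprod_map (functor_cat A B) (pointwise_coprods A B K) J \<phi>) a =
         NMap (\<phi> j) a \<cdot>\<^bsub>B\<^esub> Inj K J (\<lambda>j\<in>J. FOb (G j) a) j" if "j \<in> J" for j
      using arg_cong[OF m(2)[OF that], of "\<lambda>\<alpha>. NMap \<alpha> a"] a
      by (simp add: pointwise_coprods_def cong: restrict_cong)
  qed
  then show ?thesis by simp
qed


section \<open>Products\<close>

locale category_with_products = category C for C :: "('o, 'm) cat" (structure) +
  fixes P :: "('o, 'm) prods"
  assumes products: "chosen_products C P"
begin

lemma is_product:
  assumes "a \<in> Ob C" "b \<in> Ob C"
  shows "is_product C a b (PObj P a b) (Fst P a b) (Snd P a b)"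
  using assms products by (simp add: chosen_products_def)

lemma prod_cone:
  assumes "a \<in> Ob C" "b \<in> Ob C"
  shows prod_ob: "PObj P a b \<in> Ob C"
    and fst_hom: "Fst P a b \<in> hom C (PObj P a b) a"
    and snd_hom: "Snd P a b \<in> hom C (PObj P a b) b"
  using is_product[OF assms] by (simp_all add: is_product_def)

lemma prod_pair:
  assumes f: "f \<in> hom C d a" and g: "g \<in> hom C d b"
  shows "\<exists>!m. m \<in> hom C d (PObj P a b) \<and> m \<cdot> Fst P a b = f \<and> m \<cdot> Snd P a b = g"
proof -
  note ob = hom_ob[OF f] hom_ob[OF g]
  have "\<forall>d\<in>Ob C. \<forall>f\<in>hom C d a. \<forall>g\<in>hom C d b.
      \<exists>!m. m \<in> hom C d (PObj P a b) \<and> m \<cdot> Fst P a b = f \<and> m \<cdot> Snd P a b = g"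
    using is_product[OF ob(2,4)] unfolding is_product_def by simp
  from this[THEN bspec, OF ob(1), THEN bspec, OF f, THEN bspec, OF g] show ?thesis .
qed

text \<open>Both arrows are the pairing of the same two arrows, so the projections are jointly
  monic.\<close>

lemma prod_eqI:
  assumes ab: "a \<in> Ob C" "b \<in> Ob C"
    and m: "m \<in> hom C d (PObj P a b)" "m' \<in> hom C d (PObj P a b)"
    and eq: "m \<cdot> Fst P a b = m' \<cdot> Fst P a b" "m \<cdot> Snd P a b = m' \<cdot> Snd P a b"
  shows "m = m'"
  using prod_pair[OF comp_hom[OF m(1) fst_hom[OF ab]] comp_hom[OF m(1) snd_hom[OF ab]]] m eq by metis

lemma prod_map_unique:
  assumes f: "f \<in> hom C a a'" and g: "g \<in> hom C b b'"
  shows "\<exists>!m. m \<in> hom C (PObj P a b) (PObj P a' b') \<and>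
    m \<cdot> Fst P a' b' = Fst P a b \<cdot> f \<and> m \<cdot> Snd P a' b' = Snd P a b \<cdot> g"
proof -
  note ab = hom_ob(1)[OF f] hom_ob(1)[OF g]
  show ?thesis
    by (rule prod_pair[OF comp_hom[OF fst_hom[OF ab] f] comp_hom[OF snd_hom[OF ab] g]])
qed

lemma prod_map_eq:
  assumes f: "f \<in> hom C a a'" and g: "g \<in> hom C b b'"
  shows "prod_map C P f g = (THE m. m \<in> hom C (PObj P a b) (PObj P a' b') \<and>
    m \<cdot> Fst P a' b' = Fst P a b \<cdot> f \<and> m \<cdot> Snd P a' b' = Snd P a b \<cdot> g)"
  using homD[OF f] homD[OF g] by (simp add: prod_map_def)

lemma prod_map:
  assumes f: "f \<in> hom C a a'" and g: "g \<in> hom C b b'"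
  shows prod_map_hom: "prod_map C P f g \<in> hom C (PObj P a b) (PObj P a' b')"
    and prod_map_fst: "prod_map C P f g \<cdot> Fst P a' b' = Fst P a b \<cdot> f"
    and prod_map_snd: "prod_map C P f g \<cdot> Snd P a' b' = Snd P a b \<cdot> g"
  using theI'[OF prod_map_unique[OF f g]] prod_map_eq[OF f g] by simp_all

lemma prod_map_eqI:
  assumes f: "f \<in> hom C a a'" and g: "g \<in> hom C b b'"
    and m: "m \<in> hom C (PObj P a b) (PObj P a' b')"
      "m \<cdot> Fst P a' b' = Fst P a b \<cdot> f" "m \<cdot> Snd P a' b' = Snd P a b \<cdot> g"
  shows "prod_map C P f g = m"
  unfolding prod_map_eq[OF f g]
  by (rule the1_equality[OF prod_map_unique[OF f g]]) (intro conjI m)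

lemma prod_map_Ident:
  assumes ab: "a \<in> Ob C" "b \<in> Ob C"
  shows "prod_map C P (Ident C a) (Ident C b) = Ident C (PObj P a b)"
proof (rule prod_map_eqI[OF id_hom[OF ab(1)] id_hom[OF ab(2)] id_hom[OF prod_ob[OF ab]]])
  note fst = fst_hom[OF ab] and snd = snd_hom[OF ab]
  show "Ident C (PObj P a b) \<cdot> Fst P a b = Fst P a b \<cdot> Ident C a"
    "Ident C (PObj P a b) \<cdot> Snd P a b = Snd P a b \<cdot> Ident C b"
    using id_comp[OF fst] comp_id[OF fst] id_comp[OF snd] comp_id[OF snd] by simp_all
qed

lemma prod_map_comp:
  assumes f: "f \<in> hom C a a'" "f' \<in> hom C a' a''" and g: "g \<in> hom C b b'" "g' \<in> hom C b' b''"
  shows "prod_map C P (f \<cdot> f') (g \<cdot> g') = prod_map C P f g \<cdot> prod_map C P f' g'"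
proof (rule prod_map_eqI[OF comp_hom[OF f] comp_hom[OF g]])
  note m = prod_map[OF f(1) g(1)] and m' = prod_map[OF f(2) g(2)]
  note ob = hom_ob[OF f(1)] hom_ob[OF g(1)] hom_ob(2)[OF f(2)] hom_ob(2)[OF g(2)]
  note p = prod_cone[OF ob(1,3)] and p' = prod_cone[OF ob(2,4)] and p'' = prod_cone[OF ob(5,6)]
  show "prod_map C P f g \<cdot> prod_map C P f' g' \<in> hom C (PObj P a b) (PObj P a'' b'')"
    by (rule comp_hom[OF m(1) m'(1)])
  show "prod_map C P f g \<cdot> prod_map C P f' g' \<cdot> Fst P a'' b'' = Fst P a b \<cdot> (f \<cdot> f')"
    using comp_assoc[OF m(1) m'(1) p''(2)] comp_assoc[OF m(1) p'(2) f(2)] comp_assoc[OF p(2) f] m(2) m'(2)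
    by simp
  show "prod_map C P f g \<cdot> prod_map C P f' g' \<cdot> Snd P a'' b'' = Snd P a b \<cdot> (g \<cdot> g')"
    using comp_assoc[OF m(1) m'(1) p''(3)] comp_assoc[OF m(1) p'(3) g(2)] comp_assoc[OF p(3) g] m(3) m'(3)
    by simp
qed

end

section \<open>Pointwise products of functors\<close>

lemma prod_functor_simps:
  "a \<in> Ob A \<Longrightarrow> FOb (prod_functor A B P F G) a = PObj P (FOb F a) (FOb G a)"
  "f \<in> hom A x y \<Longrightarrow> FArr (prod_functor A B P F G) f = prod_map B P (FArr F f) (FArr G f)"
  by (auto simp: prod_functor_def hom_def)

lemma is_functor_prod:
  assumes "category A" "category_with_products B P"
    and F: "is_functor A B F" and G: "is_functor A B G"
  shows "is_functor A B (prod_functor A B P F G)"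
proof (rule is_functorI)
  interpret A: category A by fact
  interpret B: category_with_products B P by fact
  show "FOb (prod_functor A B P F G) a \<in> Ob B" if "a \<in> Ob A" for a
    using B.prod_ob[OF functor_ob[OF F that] functor_ob[OF G that]] that by (simp add: prod_functor_simps)
  show "FArr (prod_functor A B P F G) f \<in>
      hom B (FOb (prod_functor A B P F G) a) (FOb (prod_functor A B P F G) b)"
    if f: "f \<in> hom A a b" for f a b
    using A.hom_ob[OF f] B.prod_map_hom[OF functor_hom[OF F f] functor_hom[OF G f]]
    by (simp add: prod_functor_simps(1) prod_functor_simps(2)[OF f])
  show "FArr (prod_functor A B P F G) (Ident A a) = Ident B (FOb (prod_functor A B P F G) a)"
    if a: "a \<in> Ob A" for a
    using B.prod_map_Ident[OF functor_ob[OF F a] functor_ob[OF G a]]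
    by (simp add: prod_functor_simps(1)[OF a] prod_functor_simps(2)[OF A.id_hom[OF a]]
        functor_id[OF F a] functor_id[OF G a])
  show "FArr (prod_functor A B P F G) (f \<cdot>\<^bsub>A\<^esub> g) =
      FArr (prod_functor A B P F G) f \<cdot>\<^bsub>B\<^esub> FArr (prod_functor A B P F G) g"
    if f: "f \<in> hom A a b" and g: "g \<in> hom A b c" for f g a b c
    using B.prod_map_comp[OF functor_hom[OF F f] functor_hom[OF F g] functor_hom[OF G f] functor_hom[OF G g]]
    by (simp add: prod_functor_simps(2)[OF f] prod_functor_simps(2)[OF g]
        prod_functor_simps(2)[OF A.comp_hom[OF f g]] functor_comp[OF F f g] functor_comp[OF G f g])
qed (auto simp: prod_functor_def)

lemma NMap_pointwise_prods:
  assumes "a \<in> Ob A"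
  shows "NMap (Fst (pointwise_prods A B P) F G) a = Fst P (FOb F a) (FOb G a)"
    and "NMap (Snd (pointwise_prods A B P) F G) a = Snd P (FOb F a) (FOb G a)"
  using assms by (simp_all add: pointwise_prods_def)

lemma products_functor_cat:
  assumes "category A" "category_with_products B P"
  shows "category_with_products (functor_cat A B) (pointwise_prods A B P)"
proof -
  interpret A: category A by fact
  interpret B: category_with_products B P by fact
  interpret AB: category "functor_cat A B" by (rule category_functor_cat) unfold_locales
  let ?Q = "prod_functor A B P" and ?fst = "Fst (pointwise_prods A B P)" and ?snd = "Snd (pointwise_prods A B P)"
  have "is_product (functor_cat A B) F G (?Q F G) (?fst F G) (?snd F G)"
    if F: "is_functor A B F" and G: "is_functor A B G" for F G
  proof -
    note Q = is_functor_prod[OF assms F G]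
    note Fob = functor_ob[OF F] and Gob = functor_ob[OF G]
    have fst: "?fst F G \<in> hom (functor_cat A B) (?Q F G) F"
    proof -
      have "\<lparr> NDom = ?Q F G, NCod = F, NMap = (\<lambda>a\<in>Ob A. Fst P (FOb F a) (FOb G a)) \<rparr>
        \<in> hom (functor_cat A B) (?Q F G) F"
      proof (rule homI_functor_cat[OF assms(1) Q F])
        show "Fst P (FOb F a) (FOb G a) \<in> hom B (FOb (?Q F G) a) (FOb F a)" if a: "a \<in> Ob A" for a
          using B.fst_hom[OF Fob[OF a] Gob[OF a]] a by (simp add: prod_functor_simps)
        show "FArr (?Q F G) f \<cdot>\<^bsub>B\<^esub> Fst P (FOb F b) (FOb G b) = Fst P (FOb F a) (FOb G a) \<cdot>\<^bsub>B\<^esub> FArr F f"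
          if f: "f \<in> hom A a b" for f a b
          using B.prod_map_fst[OF functor_hom[OF F f] functor_hom[OF G f]] by (simp add: prod_functor_simps(2)[OF f])
      qed
      then show ?thesis by (simp add: pointwise_prods_def)
    qed
    have snd: "?snd F G \<in> hom (functor_cat A B) (?Q F G) G"
    proof -
      have "\<lparr> NDom = ?Q F G, NCod = G, NMap = (\<lambda>a\<in>Ob A. Snd P (FOb F a) (FOb G a)) \<rparr>
        \<in> hom (functor_cat A B) (?Q F G) G"
      proof (rule homI_functor_cat[OF assms(1) Q G])
        show "Snd P (FOb F a) (FOb G a) \<in> hom B (FOb (?Q F G) a) (FOb G a)" if a: "a \<in> Ob A" for a
          using B.snd_hom[OF Fob[OF a] Gob[OF a]] a by (simp add: prod_functor_simps)
        show "FArr (?Q F G) f \<cdot>\<^bsub>B\<^esub> Snd P (FOb F b) (FOb G b) = Snd P (FOb F a) (FOb G a) \<cdot>\<^bsub>B\<^esub> FArr G f"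
          if f: "f \<in> hom A a b" for f a b
          using B.prod_map_snd[OF functor_hom[OF F f] functor_hom[OF G f]] by (simp add: prod_functor_simps(2)[OF f])
      qed
      then show ?thesis by (simp add: pointwise_prods_def)
    qed
    have "\<exists>!m. m \<in> hom (functor_cat A B) H (?Q F G) \<and> m \<cdot>\<^bsub>functor_cat A B\<^esub> ?fst F G = \<phi> \<and>
        m \<cdot>\<^bsub>functor_cat A B\<^esub> ?snd F G = \<psi>"
      if \<phi>: "\<phi> \<in> hom (functor_cat A B) H F" and \<psi>: "\<psi> \<in> hom (functor_cat A B) H G" for H \<phi> \<psi>
    proof (rule ex_ex1I)
      note H = ntrans_dom[OF \<phi>]
      have "\<forall>a\<in>Ob A. \<exists>m. m \<in> hom B (FOb H a) (PObj P (FOb F a) (FOb G a)) \<and>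
          m \<cdot>\<^bsub>B\<^esub> Fst P (FOb F a) (FOb G a) = NMap \<phi> a \<and> m \<cdot>\<^bsub>B\<^esub> Snd P (FOb F a) (FOb G a) = NMap \<psi> a"
        using B.prod_pair[OF ntrans_component[OF \<phi>] ntrans_component[OF \<psi>]]
        by (intro ballI ex1_implies_ex)
      from bchoice[OF this] obtain \<eta> where
        "\<forall>a\<in>Ob A. \<eta> a \<in> hom B (FOb H a) (PObj P (FOb F a) (FOb G a)) \<and>
          \<eta> a \<cdot>\<^bsub>B\<^esub> Fst P (FOb F a) (FOb G a) = NMap \<phi> a \<and> \<eta> a \<cdot>\<^bsub>B\<^esub> Snd P (FOb F a) (FOb G a) = NMap \<psi> a"
        by (rule exE)
      then have \<eta>: "\<And>a. a \<in> Ob A \<Longrightarrow> \<eta> a \<in> hom B (FOb H a) (PObj P (FOb F a) (FOb G a))"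
        and \<eta>_fst: "\<And>a. a \<in> Ob A \<Longrightarrow> \<eta> a \<cdot>\<^bsub>B\<^esub> Fst P (FOb F a) (FOb G a) = NMap \<phi> a"
        and \<eta>_snd: "\<And>a. a \<in> Ob A \<Longrightarrow> \<eta> a \<cdot>\<^bsub>B\<^esub> Snd P (FOb F a) (FOb G a) = NMap \<psi> a"
        by simp_all
      let ?m = "\<lparr> NDom = H, NCod = ?Q F G, NMap = restrict \<eta> (Ob A) \<rparr>"
      have m: "?m \<in> hom (functor_cat A B) H (?Q F G)"
      proof (rule homI_functor_cat[OF assms(1) H Q])
        show "\<eta> a \<in> hom B (FOb H a) (FOb (?Q F G) a)" if "a \<in> Ob A" for a
          using \<eta>[OF that] that by (simp add: prod_functor_simps)
        show "FArr H f \<cdot>\<^bsub>B\<^esub> \<eta> b = \<eta> a \<cdot>\<^bsub>B\<^esub> FArr (?Q F G) f" if f: "f \<in> hom A a b" for f a b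
          unfolding prod_functor_simps(2)[OF f]
        \<comment> \<open>Tested on the two projections, the square becomes naturality of
          \<open>\<phi>\<close> and of \<open>\<psi>\<close>.\<close>
        proof (rule B.prod_eqI)
          note ab = A.hom_ob[OF f]
          note hs = functor_hom[OF H f] functor_hom[OF F f] functor_hom[OF G f]
          note fg = B.prod_map[OF hs(2,3)]
          note pb = B.prod_cone[OF Fob[OF ab(2)] Gob[OF ab(2)]]
          note pa = B.prod_cone[OF Fob[OF ab(1)] Gob[OF ab(1)]]
          show "FOb F b \<in> Ob B" "FOb G b \<in> Ob B" using Fob Gob ab by simp_all
          show "FArr H f \<cdot>\<^bsub>B\<^esub> \<eta> b \<in> hom B (FOb H a) (PObj P (FOb F b) (FOb G b))"
            by (rule B.comp_hom[OF hs(1) \<eta>[OF ab(2)]])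
          show "\<eta> a \<cdot>\<^bsub>B\<^esub> prod_map B P (FArr F f) (FArr G f) \<in> hom B (FOb H a) (PObj P (FOb F b) (FOb G b))"
            by (rule B.comp_hom[OF \<eta>[OF ab(1)] fg(1)])
          show "FArr H f \<cdot>\<^bsub>B\<^esub> \<eta> b \<cdot>\<^bsub>B\<^esub> Fst P (FOb F b) (FOb G b) =
              \<eta> a \<cdot>\<^bsub>B\<^esub> prod_map B P (FArr F f) (FArr G f) \<cdot>\<^bsub>B\<^esub> Fst P (FOb F b) (FOb G b)"
            using B.comp_assoc[OF hs(1) \<eta>[OF ab(2)] pb(2)] B.comp_assoc[OF \<eta>[OF ab(1)] fg(1) pb(2)]
              B.comp_assoc[OF \<eta>[OF ab(1)] pa(2) hs(2)] \<eta>_fst[OF ab(1)] \<eta>_fst[OF ab(2)] fg(2)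
              ntrans_natural[OF \<phi> f]
            by simp
          show "FArr H f \<cdot>\<^bsub>B\<^esub> \<eta> b \<cdot>\<^bsub>B\<^esub> Snd P (FOb F b) (FOb G b) =
              \<eta> a \<cdot>\<^bsub>B\<^esub> prod_map B P (FArr F f) (FArr G f) \<cdot>\<^bsub>B\<^esub> Snd P (FOb F b) (FOb G b)"
            using B.comp_assoc[OF hs(1) \<eta>[OF ab(2)] pb(3)] B.comp_assoc[OF \<eta>[OF ab(1)] fg(1) pb(3)]
              B.comp_assoc[OF \<eta>[OF ab(1)] pa(3) hs(3)] \<eta>_snd[OF ab(1)] \<eta>_snd[OF ab(2)] fg(3)
              ntrans_natural[OF \<psi> f]
            by simp
        qed
      qed
      moreover have "?m \<cdot>\<^bsub>functor_cat A B\<^esub> ?fst F G = \<phi>"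
        by (rule ntrans_ext[OF AB.comp_hom[OF m fst] \<phi>]) (simp add: NMap_pointwise_prods \<eta>_fst)
      moreover have "?m \<cdot>\<^bsub>functor_cat A B\<^esub> ?snd F G = \<psi>"
        by (rule ntrans_ext[OF AB.comp_hom[OF m snd] \<psi>]) (simp add: NMap_pointwise_prods \<eta>_snd)
      ultimately show "\<exists>m. m \<in> hom (functor_cat A B) H (?Q F G) \<and> m \<cdot>\<^bsub>functor_cat A B\<^esub> ?fst F G = \<phi> \<and>
        m \<cdot>\<^bsub>functor_cat A B\<^esub> ?snd F G = \<psi>"
        by blast
    next
      fix m m'
      assume "m \<in> hom (functor_cat A B) H (?Q F G) \<and> m \<cdot>\<^bsub>functor_cat A B\<^esub> ?fst F G = \<phi> \<and>
        m \<cdot>\<^bsub>functor_cat A B\<^esub> ?snd F G = \<psi>"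
        and "m' \<in> hom (functor_cat A B) H (?Q F G) \<and> m' \<cdot>\<^bsub>functor_cat A B\<^esub> ?fst F G = \<phi> \<and>
        m' \<cdot>\<^bsub>functor_cat A B\<^esub> ?snd F G = \<psi>"
      then have m: "m \<in> hom (functor_cat A B) H (?Q F G)" "m' \<in> hom (functor_cat A B) H (?Q F G)"
        and eq: "m \<cdot>\<^bsub>functor_cat A B\<^esub> ?fst F G = m' \<cdot>\<^bsub>functor_cat A B\<^esub> ?fst F G"
          "m \<cdot>\<^bsub>functor_cat A B\<^esub> ?snd F G = m' \<cdot>\<^bsub>functor_cat A B\<^esub> ?snd F G"
        by auto
      show "m = m'"
      proof (rule ntrans_ext[OF m])
        fix a assume a: "a \<in> Ob A"
        show "NMap m a = NMap m' a"
          by (rule B.prod_eqI[OF Fob[OF a] Gob[OF a]])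
            (use a m[THEN ntrans_component, OF a] eq[THEN arg_cong[where f = "\<lambda>\<alpha>. NMap \<alpha> a"]]
              in \<open>simp_all add: prod_functor_simps NMap_pointwise_prods\<close>)
      qed
    qed
    then show ?thesis
      using Q fst snd by (simp add: is_product_def)
  qed
  then show ?thesis
    by unfold_locales (simp add: chosen_products_def pointwise_prods_def)
qed


section \<open>Limits of cochains\<close>

lemma (in category) omega_coneI:
  assumes "\<And>n. p n \<in> hom C L (x n)" "\<And>n. p (Suc n) \<cdot> d n = p n"
  shows "omega_cone C x d L p"
  using assms hom_ob(1)[OF assms(1)] by (simp add: omega_cone_def)

lemma omega_coneD:
  assumes "omega_cone C x d L p"
  shows "L \<in> Ob C" "p n \<in> hom C L (x n)" "p (Suc n) \<cdot>\<^bsub>C\<^esub> d n = p n"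
  using assms by (simp_all add: omega_cone_def)

lemma cochainD:
  assumes "cochain C x d"
  shows "x n \<in> Ob C" "d n \<in> hom C (x (Suc n)) (x n)"
  using assms by (simp_all add: cochain_def)

lemma omega_limitD:
  assumes "omega_limit C x d L p"
  shows omega_limit_cochain: "cochain C x d"
    and omega_limit_cone: "omega_cone C x d L p"
    and omega_limit_lift: "omega_cone C x d M q \<Longrightarrow> \<exists>!m. m \<in> hom C M L \<and> (\<forall>n. m \<cdot>\<^bsub>C\<^esub> p n = q n)"
  using assms unfolding omega_limit_def by simp_all

lemma (in category) omega_cone_comp:
  assumes p: "omega_cone C x d L p" and d: "cochain C x d" and m: "m \<in> hom C M L"
  shows "omega_cone C x d M (\<lambda>n. m \<cdot> p n)"
proof (rule omega_coneI)
  note p = omega_coneD[OF p]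
  show "m \<cdot> p n \<in> hom C M (x n)" for n by (rule comp_hom[OF m p(2)])
  show "m \<cdot> p (Suc n) \<cdot> d n = m \<cdot> p n" for n
    using comp_assoc[OF m p(2) cochainD(2)[OF d]] p(3) by simp
qed

lemma (in category) omega_limit_eqI:
  assumes L: "omega_limit C x d L p" and m: "m \<in> hom C M L" "m' \<in> hom C M L"
    and eq: "\<And>n. m \<cdot> p n = m' \<cdot> p n"
  shows "m = m'"
  using omega_limit_lift[OF L omega_cone_comp[OF omega_limit_cone[OF L] omega_limit_cochain[OF L] m(1)]]
    m eq by metis

text \<open>Serves twice: a limit given abstractly inherits properties of a constructed one, and the
  isomorphism provided by distributivity turns a coproduct of limits into a limit.\<close>

lemma (in category) omega_limit_iso:
  assumes L: "omega_limit C x d L p" and m: "m \<in> hom C M L" "is_iso C m"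
  shows "omega_limit C x d M (\<lambda>n. m \<cdot> p n)"
proof -
  note p = omega_coneD(2)[OF omega_limit_cone[OF L]]
  obtain k where k: "k \<in> hom C L M" "m \<cdot> k = Ident C M" "k \<cdot> m = Ident C L"
    using m homD(2,3)[OF m(1)] unfolding is_iso_def by auto
  have "\<exists>!h. h \<in> hom C N M \<and> (\<forall>n. h \<cdot> (m \<cdot> p n) = q n)" if q: "omega_cone C x d N q" for N q
  proof (rule ex_ex1I)
    obtain h where h: "h \<in> hom C N L" "\<And>n. h \<cdot> p n = q n"
      using ex1_implies_ex[OF omega_limit_lift[OF L q]] by blast
    \<comment> \<open>\<open>h\<close> lifts the cone to \<open>L\<close>; the inverse
      \<open>k\<close> of \<open>m\<close> carries the lift over to \<open>M\<close>.\<close>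
    have "h \<cdot> k \<cdot> (m \<cdot> p n) = q n" for n
      using comp_assoc[OF h(1) k(1) comp_hom[OF m(1) p]] comp_assoc[OF k(1) m(1) p, symmetric] id_comp[OF p] k(3) h(2)
      by simp
    then show "\<exists>h. h \<in> hom C N M \<and> (\<forall>n. h \<cdot> (m \<cdot> p n) = q n)"
      using comp_hom[OF h(1) k(1)] by blast
  next
    fix h h'
    assume "h \<in> hom C N M \<and> (\<forall>n. h \<cdot> (m \<cdot> p n) = q n)" "h' \<in> hom C N M \<and> (\<forall>n. h' \<cdot> (m \<cdot> p n) = q n)"
    then have h: "h \<in> hom C N M" "h' \<in> hom C N M" and eq: "\<And>n. h \<cdot> (m \<cdot> p n) = h' \<cdot> (m \<cdot> p n)"
      by simp_all
    \<comment> \<open>Uniqueness is compared after \<open>m\<close>, where the legs of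
      \<open>L\<close> decide; \<open>k\<close> then cancels \<open>m\<close>.\<close>
    have "h \<cdot> m = h' \<cdot> m"
      by (rule omega_limit_eqI[OF L comp_hom[OF h(1) m(1)] comp_hom[OF h(2) m(1)]])
        (simp add: comp_assoc[OF h(1) m(1) p] comp_assoc[OF h(2) m(1) p] eq)
    then have "h \<cdot> m \<cdot> k = h' \<cdot> m \<cdot> k" by simp
    then show "h = h'"
      by (simp add: comp_assoc[OF h(1) m(1) k(1)] comp_assoc[OF h(2) m(1) k(1)] k(2) comp_id[OF h(1)] comp_id[OF h(2)])
  qed
  then show ?thesis
    using omega_limit_cochain[OF L] omega_cone_comp[OF omega_limit_cone[OF L] omega_limit_cochain[OF L] m(1)]
    unfolding omega_limit_def by blast
qed

text \<open>Each cone is lifted along the other; the two composites agree with the identities on all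
  legs.\<close>

lemma (in category) omega_limit_unique:
  assumes L: "omega_limit C x d L p" and L': "omega_limit C x d L' p'"
  obtains m where "m \<in> hom C L L'" "is_iso C m" "\<And>n. m \<cdot> p' n = p n"
proof -
  note c = omega_limit_cone[OF L] omega_limit_cone[OF L']
  obtain m where m: "m \<in> hom C L L'" "\<And>n. m \<cdot> p' n = p n"
    using ex1_implies_ex[OF omega_limit_lift[OF L' c(1)]] by blast
  obtain k where k: "k \<in> hom C L' L" "\<And>n. k \<cdot> p n = p' n"
    using ex1_implies_ex[OF omega_limit_lift[OF L c(2)]] by blast
  note p = omega_coneD(2)[OF c(1)] and p' = omega_coneD(2)[OF c(2)]
  note ids = id_hom[OF omega_coneD(1)[OF c(1)]] id_hom[OF omega_coneD(1)[OF c(2)]]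
  have "m \<cdot> k = Ident C L"
    by (rule omega_limit_eqI[OF L comp_hom[OF m(1) k(1)] ids(1)])
      (simp add: comp_assoc[OF m(1) k(1) p] id_comp[OF p] m(2) k(2))
  moreover have "k \<cdot> m = Ident C L'"
    by (rule omega_limit_eqI[OF L' comp_hom[OF k(1) m(1)] ids(2)])
      (simp add: comp_assoc[OF k(1) m(1) p'] id_comp[OF p'] m(2) k(2))
  ultimately have "is_iso C m"
    using homD[OF m(1)] k(1) unfolding is_iso_def by (intro conjI bexI[of _ k]) simp_all
  then show thesis by (rule that[OF m(1) _ m(2)])
qed

lemma omega_cone_functor:
  assumes "category B" and F: "is_functor A B F" and d: "cochain A x d" and p: "omega_cone A x d L p"
  shows "omega_cone B (\<lambda>n. FOb F (x n)) (\<lambda>n. FArr F (d n)) (FOb F L) (\<lambda>n. FArr F (p n))"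
proof (rule category.omega_coneI[OF assms(1)])
  note p = omega_coneD[OF p] and d = cochainD[OF d]
  show "FArr F (p n) \<in> hom B (FOb F L) (FOb F (x n))" for n by (rule functor_hom[OF F p(2)])
  show "FArr F (p (Suc n)) \<cdot>\<^bsub>B\<^esub> FArr F (d n) = FArr F (p n)" for n
    by (simp add: functor_comp[OF F p(2) d(2), symmetric] p(3))
qed

lemma cochain_functor:
  assumes F: "is_functor A B F" and d: "cochain A x d"
  shows "cochain B (\<lambda>n. FOb F (x n)) (\<lambda>n. FArr F (d n))"
  using functor_ob[OF F cochainD(1)[OF d]] functor_hom[OF F cochainD(2)[OF d]] by (simp add: cochain_def)


subsection \<open>Pointwise limits\<close>

lemma cochain_component:
  assumes "cochain (functor_cat A B) x d" "a \<in> Ob A"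
  shows "cochain B (\<lambda>n. FOb (x n) a) (\<lambda>n. NMap (d n) a)"
  using ntrans_component[OF cochainD(2)[OF assms(1)] assms(2)] functor_ob[of A B "x _", OF _ assms(2)]
    cochainD(1)[OF assms(1)]
  by (simp add: cochain_def)

lemma omega_cone_component:
  assumes "category B" "omega_cone (functor_cat A B) x d L p" and a: "a \<in> Ob A"
  shows "omega_cone B (\<lambda>n. FOb (x n) a) (\<lambda>n. NMap (d n) a) (FOb L a) (\<lambda>n. NMap (p n) a)"
proof (rule category.omega_coneI[OF assms(1)])
  note p = omega_coneD[OF assms(2)]
  show "NMap (p n) a \<in> hom B (FOb L a) (FOb (x n) a)" for n by (rule ntrans_component[OF p(2) a])
  show "NMap (p (Suc n)) a \<cdot>\<^bsub>B\<^esub> NMap (d n) a = NMap (p n) a" for n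
    using arg_cong[OF p(3)[of n], of "\<lambda>\<alpha>. NMap \<alpha> a"] a by simp
qed

text \<open>Lifts taken at each object are automatically natural, because the legs at the target of
  the square are jointly monic.\<close>

lemma omega_limit_pointwiseI:
  assumes "category A" "category B"
    and d: "cochain (functor_cat A B) x d" and p: "omega_cone (functor_cat A B) x d L p"
    and lim: "\<And>a. a \<in> Ob A \<Longrightarrow>
      omega_limit B (\<lambda>n. FOb (x n) a) (\<lambda>n. NMap (d n) a) (FOb L a) (\<lambda>n. NMap (p n) a)"
  shows "omega_limit (functor_cat A B) x d L p"
proof -
  interpret A: category A by fact
  interpret B: category B by fact
  interpret AB: category "functor_cat A B" by (rule category_functor_cat) fact+
  note p' = omega_coneD[OF p]
  from p'(1) have L: "is_functor A B L" by simp
  have "\<exists>!m. m \<in> hom (functor_cat A B) M L \<and> (\<forall>n. m \<cdot>\<^bsub>functor_cat A B\<^esub> p n = q n)"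
    if q: "omega_cone (functor_cat A B) x d M q" for M q
  proof (rule ex_ex1I)
    note q' = omega_coneD[OF q]
    from q'(1) have M: "is_functor A B M" by simp
    have "\<forall>a\<in>Ob A. \<exists>m. m \<in> hom B (FOb M a) (FOb L a) \<and> (\<forall>n. m \<cdot>\<^bsub>B\<^esub> NMap (p n) a = NMap (q n) a)"
      using omega_limit_lift[OF lim omega_cone_component[OF assms(2) q]]
      by (intro ballI ex1_implies_ex)
    from bchoice[OF this] obtain \<eta> where
      "\<forall>a\<in>Ob A. \<eta> a \<in> hom B (FOb M a) (FOb L a) \<and> (\<forall>n. \<eta> a \<cdot>\<^bsub>B\<^esub> NMap (p n) a = NMap (q n) a)"
      by (rule exE)
    then have \<eta>: "\<And>a. a \<in> Ob A \<Longrightarrow> \<eta> a \<in> hom B (FOb M a) (FOb L a)"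
      and \<eta>p: "\<And>a n. a \<in> Ob A \<Longrightarrow> \<eta> a \<cdot>\<^bsub>B\<^esub> NMap (p n) a = NMap (q n) a"
      by simp_all
    let ?m = "\<lparr> NDom = M, NCod = L, NMap = restrict \<eta> (Ob A) \<rparr>"
    have m: "?m \<in> hom (functor_cat A B) M L"
    proof (rule homI_functor_cat[OF assms(1) M L \<eta>])
      fix f a b assume f: "f \<in> hom A a b"
      note ab = A.hom_ob[OF f] and Mf = functor_hom[OF M f] and Lf = functor_hom[OF L f]
      show "FArr M f \<cdot>\<^bsub>B\<^esub> \<eta> b = \<eta> a \<cdot>\<^bsub>B\<^esub> FArr L f"
      proof (rule B.omega_limit_eqI[OF lim[OF ab(2)]])
        show "FArr M f \<cdot>\<^bsub>B\<^esub> \<eta> b \<in> hom B (FOb M a) (FOb L b)" by (rule B.comp_hom[OF Mf \<eta>[OF ab(2)]])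
        show "\<eta> a \<cdot>\<^bsub>B\<^esub> FArr L f \<in> hom B (FOb M a) (FOb L b)" by (rule B.comp_hom[OF \<eta>[OF ab(1)] Lf])
        fix n
        note xf = functor_hom[OF ntrans_cod[OF p'(2)] f]
        show "FArr M f \<cdot>\<^bsub>B\<^esub> \<eta> b \<cdot>\<^bsub>B\<^esub> NMap (p n) b = \<eta> a \<cdot>\<^bsub>B\<^esub> FArr L f \<cdot>\<^bsub>B\<^esub> NMap (p n) b"
          using B.comp_assoc[OF Mf \<eta>[OF ab(2)] ntrans_component[OF p'(2) ab(2)]]
            B.comp_assoc[OF \<eta>[OF ab(1)] Lf ntrans_component[OF p'(2) ab(2)]]
            B.comp_assoc[OF \<eta>[OF ab(1)] ntrans_component[OF p'(2) ab(1)] xf]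
            ntrans_natural[OF p'(2) f] ntrans_natural[OF q'(2) f] \<eta>p[OF ab(1)] \<eta>p[OF ab(2)]
          by simp
      qed
    qed
    moreover have "?m \<cdot>\<^bsub>functor_cat A B\<^esub> p n = q n" for n
      by (rule ntrans_ext[OF AB.comp_hom[OF m p'(2)] q'(2)]) (simp add: \<eta>p)
    ultimately show "\<exists>m. m \<in> hom (functor_cat A B) M L \<and> (\<forall>n. m \<cdot>\<^bsub>functor_cat A B\<^esub> p n = q n)"
      by blast
  next
    fix m m'
    assume "m \<in> hom (functor_cat A B) M L \<and> (\<forall>n. m \<cdot>\<^bsub>functor_cat A B\<^esub> p n = q n)"
      "m' \<in> hom (functor_cat A B) M L \<and> (\<forall>n. m' \<cdot>\<^bsub>functor_cat A B\<^esub> p n = q n)"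
    then have m: "m \<in> hom (functor_cat A B) M L" "m' \<in> hom (functor_cat A B) M L"
      and eq: "\<And>n. m \<cdot>\<^bsub>functor_cat A B\<^esub> p n = m' \<cdot>\<^bsub>functor_cat A B\<^esub> p n"
      by simp_all
    show "m = m'"
    proof (rule ntrans_ext[OF m])
      fix a assume a: "a \<in> Ob A"
      have "NMap m a \<cdot>\<^bsub>B\<^esub> NMap (p n) a = NMap m' a \<cdot>\<^bsub>B\<^esub> NMap (p n) a" for n
        using arg_cong[OF eq[of n], of "\<lambda>\<alpha>. NMap \<alpha> a"] a by simp
      then show "NMap m a = NMap m' a"
        by (rule B.omega_limit_eqI[OF lim[OF a] m[THEN ntrans_component, OF a]])
    qed
  qed
  then show ?thesis
    using d p unfolding omega_limit_def by blast
qed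

text \<open>Limits chosen at the objects become a functor by their universal property. The
  conclusion keeps the componentwise limits, since \<open>omega_limit_component\<close> compares
  with them.\<close>

lemma pointwise_omega_limit_exists:
  assumes "category A" "category B" "has_omega_limits B" and d: "cochain (functor_cat A B) x d"
  obtains L p where "omega_limit (functor_cat A B) x d L p"
    and "\<And>a. a \<in> Ob A \<Longrightarrow>
      omega_limit B (\<lambda>n. FOb (x n) a) (\<lambda>n. NMap (d n) a) (FOb L a) (\<lambda>n. NMap (p n) a)"
proof -
  interpret A: category A by fact
  interpret B: category B by fact
  interpret AB: category "functor_cat A B" by (rule category_functor_cat) fact+
  note d' = cochainD(2)[OF d]
  have x: "is_functor A B (x n)" for n using cochainD(1)[OF d] by simp
  \<comment> \<open>Apex and legs are paired, so that a single choice selects both.\<close>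
  have "\<forall>a\<in>Ob A. \<exists>Lp. omega_limit B (\<lambda>n. FOb (x n) a) (\<lambda>n. NMap (d n) a) (fst Lp) (snd Lp)"
    using assms(3) cochain_component[OF d] unfolding has_omega_limits_def by simp
  from bchoice[OF this] obtain Lp where
    "\<forall>a\<in>Ob A. omega_limit B (\<lambda>n. FOb (x n) a) (\<lambda>n. NMap (d n) a) (fst (Lp a)) (snd (Lp a))"
    by (rule exE)
  then have lim: "omega_limit B (\<lambda>n. FOb (x n) a) (\<lambda>n. NMap (d n) a) (fst (Lp a)) (snd (Lp a))"
    if "a \<in> Ob A" for a using that by simp
  define l \<pi> where "l a = fst (Lp a)" and "\<pi> a = snd (Lp a)" for a
  have lim: "omega_limit B (\<lambda>n. FOb (x n) a) (\<lambda>n. NMap (d n) a) (l a) (\<pi> a)"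
    if "a \<in> Ob A" for a using lim[OF that] by (simp add: l_def \<pi>_def)
  note \<pi> = omega_coneD[OF omega_limit_cone[OF lim]]
  \<comment> \<open>The action on \<open>f\<close> lifts the legs at \<open>Dom A f\<close> followed
    by \<open>FArr (x n) f\<close>; that these form a cone is naturality of
    \<open>d n\<close>.\<close>
  have "\<forall>f\<in>Arr A. \<exists>m. m \<in> hom B (l (Dom A f)) (l (Cod A f)) \<and>
      (\<forall>n. m \<cdot>\<^bsub>B\<^esub> \<pi> (Cod A f) n = \<pi> (Dom A f) n \<cdot>\<^bsub>B\<^esub> FArr (x n) f)"
  proof (intro ballI ex1_implies_ex omega_limit_lift B.omega_coneI)
    fix f n assume "f \<in> Arr A"
    then have f: "f \<in> hom A (Dom A f) (Cod A f)" by (rule Arr_hom)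
    note ab = A.hom_ob[OF f]
    note xf = functor_hom[OF x f]
    show "omega_limit B (\<lambda>n. FOb (x n) (Cod A f)) (\<lambda>n. NMap (d n) (Cod A f)) (l (Cod A f)) (\<pi> (Cod A f))"
      by (rule lim[OF ab(2)])
    show "\<pi> (Dom A f) n \<cdot>\<^bsub>B\<^esub> FArr (x n) f \<in> hom B (l (Dom A f)) (FOb (x n) (Cod A f))"
      by (rule B.comp_hom[OF \<pi>(2)[OF ab(1)] xf])
    show "\<pi> (Dom A f) (Suc n) \<cdot>\<^bsub>B\<^esub> FArr (x (Suc n)) f \<cdot>\<^bsub>B\<^esub> NMap (d n) (Cod A f) =
        \<pi> (Dom A f) n \<cdot>\<^bsub>B\<^esub> FArr (x n) f"
      using B.comp_assoc[OF \<pi>(2)[OF ab(1)] xf ntrans_component[OF d' ab(2)]]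
        B.comp_assoc[OF \<pi>(2)[OF ab(1)] ntrans_component[OF d' ab(1)] xf, symmetric]
        ntrans_natural[OF d' f] \<pi>(3)[OF ab(1), of n] by simp
  qed
  from bchoice[OF this] obtain h where
    "\<forall>f\<in>Arr A. h f \<in> hom B (l (Dom A f)) (l (Cod A f)) \<and>
      (\<forall>n. h f \<cdot>\<^bsub>B\<^esub> \<pi> (Cod A f) n = \<pi> (Dom A f) n \<cdot>\<^bsub>B\<^esub> FArr (x n) f)"
    by (rule exE)
  then have h: "h f \<in> hom B (l a) (l b)" and h\<pi>: "h f \<cdot>\<^bsub>B\<^esub> \<pi> b n = \<pi> a n \<cdot>\<^bsub>B\<^esub> FArr (x n) f"
    if "f \<in> hom A a b" for f a b n using homD[OF that] by auto
  define L where "L = \<lparr> FOb = restrict l (Ob A), FArr = restrict h (Arr A) \<rparr>"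
  have L_ob: "FOb L a = l a" if "a \<in> Ob A" for a using that by (simp add: L_def)
  have L_arr: "FArr L f = h f" if "f \<in> hom A a b" for f a b using homD(1)[OF that] by (simp add: L_def)
  have L: "is_functor A B L"
  proof (rule is_functorI)
    show "FOb L a \<in> Ob B" if "a \<in> Ob A" for a using \<pi>(1)[OF that] L_ob[OF that] by simp
    show "FArr L f \<in> hom B (FOb L a) (FOb L b)" if f: "f \<in> hom A a b" for f a b
      using h[OF f] L_arr[OF f] L_ob A.hom_ob[OF f] by simp
    show "FArr L (Ident A a) = Ident B (FOb L a)" if a: "a \<in> Ob A" for a
      unfolding L_arr[OF A.id_hom[OF a]] L_ob[OF a]
    \<comment> \<open>Here and for composites, the functor law holds because both sides have the
      same composites with all legs.\<close>
    proof (rule B.omega_limit_eqI[OF lim[OF a] h[OF A.id_hom[OF a]] B.id_hom[OF \<pi>(1)[OF a]]])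
      show "h (Ident A a) \<cdot>\<^bsub>B\<^esub> \<pi> a n = Ident B (l a) \<cdot>\<^bsub>B\<^esub> \<pi> a n" for n
        using h\<pi>[OF A.id_hom[OF a]] functor_id[OF x a] B.comp_id[OF \<pi>(2)[OF a]] B.id_comp[OF \<pi>(2)[OF a]]
        by simp
    qed
    show "FArr L (f \<cdot>\<^bsub>A\<^esub> g) = FArr L f \<cdot>\<^bsub>B\<^esub> FArr L g"
      if f: "f \<in> hom A a b" and g: "g \<in> hom A b c" for f g a b c
      unfolding L_arr[OF A.comp_hom[OF f g]] L_arr[OF f] L_arr[OF g]
    proof -
      note fg = A.comp_hom[OF f g] and abc = A.hom_ob[OF f] A.hom_ob(2)[OF g]
      show "h (f \<cdot>\<^bsub>A\<^esub> g) = h f \<cdot>\<^bsub>B\<^esub> h g"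
      proof (rule B.omega_limit_eqI[OF lim[OF abc(3)] h[OF fg] B.comp_hom[OF h[OF f] h[OF g]]])
        fix n
        note xf = functor_hom[OF x f] and xg = functor_hom[OF x g]
        show "h (f \<cdot>\<^bsub>A\<^esub> g) \<cdot>\<^bsub>B\<^esub> \<pi> c n = h f \<cdot>\<^bsub>B\<^esub> h g \<cdot>\<^bsub>B\<^esub> \<pi> c n"
          using h\<pi>[OF fg, of n] functor_comp[OF x f g, of n] h\<pi>[OF f, of n] h\<pi>[OF g, of n]
            B.comp_assoc[OF h[OF f] h[OF g] \<pi>(2)[OF abc(3)]] B.comp_assoc[OF h[OF f] \<pi>(2)[OF abc(2)] xg, symmetric]
            B.comp_assoc[OF \<pi>(2)[OF abc(1)] xf xg]
          by simp
      qed
    qed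
  qed (simp_all add: L_def)
  define p where "p n = \<lparr> NDom = L, NCod = x n, NMap = (\<lambda>a\<in>Ob A. \<pi> a n) \<rparr>" for n
  have p_NMap: "NMap (p n) a = \<pi> a n" if "a \<in> Ob A" for n a using that by (simp add: p_def)
  have p: "p n \<in> hom (functor_cat A B) L (x n)" for n
    unfolding p_def
  proof (rule homI_functor_cat[OF assms(1) L x])
    show "\<pi> a n \<in> hom B (FOb L a) (FOb (x n) a)" if "a \<in> Ob A" for a
      using \<pi>(2)[OF that] L_ob[OF that] by simp
    show "FArr L f \<cdot>\<^bsub>B\<^esub> \<pi> b n = \<pi> a n \<cdot>\<^bsub>B\<^esub> FArr (x n) f" if "f \<in> hom A a b" for f a b
      using h\<pi>[OF that] L_arr[OF that] by simp
  qed
  have cone: "omega_cone (functor_cat A B) x d L p"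
  proof (rule AB.omega_coneI[OF p])
    show "p (Suc n) \<cdot>\<^bsub>functor_cat A B\<^esub> d n = p n" for n
      by (rule ntrans_ext[OF AB.comp_hom[OF p d'] p]) (simp add: p_NMap \<pi>(3))
  qed
  have "omega_limit B (\<lambda>n. FOb (x n) a) (\<lambda>n. NMap (d n) a) (FOb L a) (\<lambda>n. NMap (p n) a)"
    if "a \<in> Ob A" for a
    using lim[OF that] by (simp add: L_ob p_NMap that)
  then show thesis
    using that[of L p] omega_limit_pointwiseI[OF assms(1,2) d cone] by blast
qed

lemma has_omega_limits_functor_cat:
  assumes "category A" "category B" "has_omega_limits B"
  shows "has_omega_limits (functor_cat A B)"
  unfolding has_omega_limits_def using pointwise_omega_limit_exists[OF assms] by metis

lemma is_iso_component:
  assumes m: "m \<in> hom (functor_cat A B) F G" "is_iso (functor_cat A B) m" and a: "a \<in> Ob A"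
  shows "is_iso B (NMap m a)"
proof -
  obtain k where k: "k \<in> hom (functor_cat A B) G F"
      "m \<cdot>\<^bsub>functor_cat A B\<^esub> k = Ident (functor_cat A B) F" "k \<cdot>\<^bsub>functor_cat A B\<^esub> m = Ident (functor_cat A B) G"
    using m homD(2,3)[OF m(1)] unfolding is_iso_def by auto
  have "NMap m a \<cdot>\<^bsub>B\<^esub> NMap k a = Ident B (FOb F a)" "NMap k a \<cdot>\<^bsub>B\<^esub> NMap m a = Ident B (FOb G a)"
    using k(2,3)[THEN arg_cong[where f = "\<lambda>\<alpha>. NMap \<alpha> a"]] a by simp_all
  then show ?thesis
    using homD[OF ntrans_component[OF m(1) a]] ntrans_component[OF k(1) a]
    unfolding is_iso_def by (intro conjI bexI[of _ "NMap k a"]) simp_all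
qed

text \<open>The given limit is isomorphic to a pointwise one, and the components of the isomorphism
  transport the limits at each object. Existence of limits in \<open>B\<close> provides the object
  of comparison.\<close>

lemma omega_limit_component:
  assumes "category A" "category B" "has_omega_limits B"
    and L: "omega_limit (functor_cat A B) x d L p" and a: "a \<in> Ob A"
  shows "omega_limit B (\<lambda>n. FOb (x n) a) (\<lambda>n. NMap (d n) a) (FOb L a) (\<lambda>n. NMap (p n) a)"
proof -
  obtain L' p' where L': "omega_limit (functor_cat A B) x d L' p'"
    and lim: "omega_limit B (\<lambda>n. FOb (x n) a) (\<lambda>n. NMap (d n) a) (FOb L' a) (\<lambda>n. NMap (p' n) a)"
    using pointwise_omega_limit_exists[OF assms(1-3) omega_limit_cochain[OF L]] a by metis
  obtain m where m: "m \<in> hom (functor_cat A B) L L'" "is_iso (functor_cat A B) m"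
      "\<And>n. m \<cdot>\<^bsub>functor_cat A B\<^esub> p' n = p n"
    using category.omega_limit_unique[OF category_functor_cat[OF assms(1,2)] L L'] by metis
  have "(\<lambda>n. NMap m a \<cdot>\<^bsub>B\<^esub> NMap (p' n) a) = (\<lambda>n. NMap (p n) a)"
    using m(3)[THEN arg_cong[where f = "\<lambda>\<alpha>. NMap \<alpha> a"]] a by simp
  then show ?thesis
    using category.omega_limit_iso[OF assms(2) lim ntrans_component[OF m(1) a] is_iso_component[OF m(1,2) a]]
    by simp
qed


section \<open>Continuous functors\<close>

lemma omega_continuousD:
  assumes "omega_continuous A B F"
  shows omega_continuous_functor: "is_functor A B F"
    and omega_continuous_limit: "omega_limit A x d L p \<Longrightarrow>
      omega_limit B (\<lambda>n. FOb F (x n)) (\<lambda>n. FArr F (d n)) (FOb F L) (\<lambda>n. FArr F (p n))"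
  using assms by (simp_all add: omega_continuous_def)

lemma omega_limit_facts:
  assumes "omega_limit A x d L p"
  shows "x n \<in> Ob A" "d n \<in> hom A (x (Suc n)) (x n)" "L \<in> Ob A" "p n \<in> hom A L (x n)"
    "p (Suc n) \<cdot>\<^bsub>A\<^esub> d n = p n"
  using cochainD[OF omega_limit_cochain[OF assms]] omega_coneD[OF omega_limit_cone[OF assms]] by simp_all

text \<open>Along identities all legs of a cone coincide, the shape being connected, so the common
  leg \<open>q 0\<close> is the lift. This makes constant functors continuous.\<close>

lemma (in category) omega_limit_const:
  assumes b: "b \<in> Ob C"
  shows "omega_limit C (\<lambda>n. b) (\<lambda>n. Ident C b) b (\<lambda>n. Ident C b)"
proof -
  note i = id_hom[OF b]
  have "\<exists>!m. m \<in> hom C M b \<and> (\<forall>n. m \<cdot> Ident C b = q n)" if q: "omega_cone C (\<lambda>n. b) (\<lambda>n. Ident C b) M q" for M q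
  proof -
    note q' = omega_coneD[OF q]
    have "q (Suc n) = q n" for n using q'(3)[of n] comp_id[OF q'(2)[of "Suc n"]] by simp
    then have q0: "q n = q 0" for n by (induction n) auto
    show ?thesis
    proof (rule ex1I[of _ "q 0"])
      have "q 0 \<cdot> Ident C b = q n" for n
        using comp_id[OF q'(2)[of 0]] q0[of n] by simp
      then show "q 0 \<in> hom C M b \<and> (\<forall>n. q 0 \<cdot> Ident C b = q n)"
        by (intro conjI q'(2) allI)
      show "m = q 0" if "m \<in> hom C M b \<and> (\<forall>n. m \<cdot> Ident C b = q n)" for m
        using spec[OF conjunct2[OF that], of 0] comp_id[OF conjunct1[OF that]] by simp
    qed
  qed
  then show ?thesis
    using b i comp_id[OF i] unfolding omega_limit_def by (simp add: cochain_def omega_cone_def)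
qed

lemma omega_continuous_const:
  assumes "category A" "category B" "b \<in> Ob B"
  shows "omega_continuous A B (const_functor A B b)"
  unfolding omega_continuous_def
proof (intro conjI allI impI is_functor_const[OF assms])
  fix x d L p assume "omega_limit A x d L p"
  note l = omega_limit_facts[OF this]
  show "omega_limit B (\<lambda>n. FOb (const_functor A B b) (x n)) (\<lambda>n. FArr (const_functor A B b) (d n))
      (FOb (const_functor A B b) L) (\<lambda>n. FArr (const_functor A B b) (p n))"
    using category.omega_limit_const[OF assms(2,3)] l(1,3)
    by (simp add: const_functor_simps(2)[OF l(2)] const_functor_simps(2)[OF l(4)])
qed

lemma omega_continuous_comp:
  assumes "category A" and F: "omega_continuous A B F" and G: "omega_continuous B E G"
  shows "omega_continuous A E (comp_functor A F G)"
  unfolding omega_continuous_def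
proof (intro conjI allI impI is_functor_comp[OF assms(1) F[THEN omega_continuous_functor] G[THEN omega_continuous_functor]])
  fix x d L p assume L: "omega_limit A x d L p"
  note l = omega_limit_facts[OF L]
  show "omega_limit E (\<lambda>n. FOb (comp_functor A F G) (x n)) (\<lambda>n. FArr (comp_functor A F G) (d n))
      (FOb (comp_functor A F G) L) (\<lambda>n. FArr (comp_functor A F G) (p n))"
    using omega_continuous_limit[OF G omega_continuous_limit[OF F L]] l(1,3)
    by (simp add: comp_functor_simps(2)[OF l(2)] comp_functor_simps(2)[OF l(4)])
qed

text \<open>At \<open>a\<close> the whiskered cochain is the image under \<open>L\<close> of the
  cochain of components at \<open>FOb K a\<close>, so continuity is asked of \<open>L\<close> and
  mere functoriality of \<open>K\<close>. The iterated option functors enter as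
  \<open>K\<close>.\<close>

lemma omega_continuous_whisker:
  assumes "category A" "category B" "category B'" "category E" "has_omega_limits B'"
    and K: "is_functor A B K" and L: "omega_continuous B' E L"
  shows "omega_continuous (functor_cat B B') (functor_cat A E) (whisker_functor A B B' K L)"
    (is "omega_continuous _ _ ?W")
  unfolding omega_continuous_def
proof (intro conjI allI impI)
  show W: "is_functor (functor_cat B B') (functor_cat A E) ?W"
    by (rule is_functor_whisker[OF assms(1-4) K omega_continuous_functor[OF L]])
  fix x d M p assume M: "omega_limit (functor_cat B B') x d M p"
  note M' = omega_limit_facts[OF M]
  show "omega_limit (functor_cat A E) (\<lambda>n. FOb ?W (x n)) (\<lambda>n. FArr ?W (d n)) (FOb ?W M) (\<lambda>n. FArr ?W (p n))"
  proof (rule omega_limit_pointwiseI[OF assms(1,4)])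
    show "cochain (functor_cat A E) (\<lambda>n. FOb ?W (x n)) (\<lambda>n. FArr ?W (d n))"
      by (rule cochain_functor[OF W omega_limit_cochain[OF M]])
    show "omega_cone (functor_cat A E) (\<lambda>n. FOb ?W (x n)) (\<lambda>n. FArr ?W (d n)) (FOb ?W M) (\<lambda>n. FArr ?W (p n))"
      by (rule omega_cone_functor[OF category_functor_cat[OF assms(1,4)] W omega_limit_cochain[OF M] omega_limit_cone[OF M]])
    fix a assume a: "a \<in> Ob A"
    note Ka = functor_ob[OF K a]
    have ob: "FOb (FOb ?W X) a = FOb L (FOb X (FOb K a))" if "X \<in> Ob (functor_cat B B')" for X
      using that a Ka by (simp add: whisker_functor_simps)
    have arr: "NMap (FArr ?W \<alpha>) a = FArr L (NMap \<alpha> (FOb K a))" if "\<alpha> \<in> hom (functor_cat B B') X Y" for \<alpha> X Y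
      using a by (simp add: whisker_functor_simps(2)[OF that])
    show "omega_limit E (\<lambda>n. FOb (FOb ?W (x n)) a) (\<lambda>n. NMap (FArr ?W (d n)) a) (FOb (FOb ?W M) a)
        (\<lambda>n. NMap (FArr ?W (p n)) a)"
      unfolding ob[OF M'(1)] ob[OF M'(3)] arr[OF M'(2)] arr[OF M'(4)]
      by (rule omega_continuous_limit[OF L omega_limit_component[OF assms(2,3,5) M Ka]])
  qed
qed


subsection \<open>Products of continuous functors\<close>

text \<open>Limits commute with products: a cone on the products amounts to a pair of cones, one for
  each factor.\<close>

lemma (in category_with_products) omega_limit_prod:
  assumes L: "omega_limit C x d L p" and L': "omega_limit C x' d' L' p'"
  shows "omega_limit C (\<lambda>n. PObj P (x n) (x' n)) (\<lambda>n. prod_map C P (d n) (d' n))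
    (PObj P L L') (\<lambda>n. prod_map C P (p n) (p' n))"
proof -
  note l = omega_limit_facts[OF L] and l' = omega_limit_facts[OF L']
  note pl = prod_cone[OF l(3) l'(3)] and px = prod_cone[OF l(1) l'(1)]
  have dm: "prod_map C P (d n) (d' n) \<in> hom C (PObj P (x (Suc n)) (x' (Suc n))) (PObj P (x n) (x' n))"
    "prod_map C P (d n) (d' n) \<cdot> Fst P (x n) (x' n) = Fst P (x (Suc n)) (x' (Suc n)) \<cdot> d n"
    "prod_map C P (d n) (d' n) \<cdot> Snd P (x n) (x' n) = Snd P (x (Suc n)) (x' (Suc n)) \<cdot> d' n" for n
    by (rule prod_map[OF l(2) l'(2)])+
  have pm: "prod_map C P (p n) (p' n) \<in> hom C (PObj P L L') (PObj P (x n) (x' n))"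
    "prod_map C P (p n) (p' n) \<cdot> Fst P (x n) (x' n) = Fst P L L' \<cdot> p n"
    "prod_map C P (p n) (p' n) \<cdot> Snd P (x n) (x' n) = Snd P L L' \<cdot> p' n" for n
    by (rule prod_map[OF l(4) l'(4)])+
  have cochain: "cochain C (\<lambda>n. PObj P (x n) (x' n)) (\<lambda>n. prod_map C P (d n) (d' n))"
    using px(1) dm(1) by (simp add: cochain_def)
  have cone: "omega_cone C (\<lambda>n. PObj P (x n) (x' n)) (\<lambda>n. prod_map C P (d n) (d' n))
      (PObj P L L') (\<lambda>n. prod_map C P (p n) (p' n))"
    by (rule omega_coneI[OF pm(1)]) (simp add: prod_map_comp[OF l(4) l(2) l'(4) l'(2), symmetric] l(5) l'(5))
  have "\<exists>!m. m \<in> hom C M (PObj P L L') \<and> (\<forall>n. m \<cdot> prod_map C P (p n) (p' n) = q n)"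
    if q: "omega_cone C (\<lambda>n. PObj P (x n) (x' n)) (\<lambda>n. prod_map C P (d n) (d' n)) M q" for M q
  proof (rule ex_ex1I)
    note q' = omega_coneD[OF q]
    \<comment> \<open>Composing with the first projections gives a cone on \<open>x\<close>, as the
      connecting maps commute with the projections.\<close>
    have c: "omega_cone C x d M (\<lambda>n. q n \<cdot> Fst P (x n) (x' n))"
    proof (rule omega_coneI)
      show "q n \<cdot> Fst P (x n) (x' n) \<in> hom C M (x n)" for n by (rule comp_hom[OF q'(2) px(2)])
      show "q (Suc n) \<cdot> Fst P (x (Suc n)) (x' (Suc n)) \<cdot> d n = q n \<cdot> Fst P (x n) (x' n)" for n
        by (simp add: comp_assoc[OF q'(2) px(2) l(2)] dm(2)[symmetric] comp_assoc[OF q'(2) dm(1) px(2), symmetric] q'(3))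
    qed
    have c': "omega_cone C x' d' M (\<lambda>n. q n \<cdot> Snd P (x n) (x' n))"
    proof (rule omega_coneI)
      show "q n \<cdot> Snd P (x n) (x' n) \<in> hom C M (x' n)" for n by (rule comp_hom[OF q'(2) px(3)])
      show "q (Suc n) \<cdot> Snd P (x (Suc n)) (x' (Suc n)) \<cdot> d' n = q n \<cdot> Snd P (x n) (x' n)" for n
        by (simp add: comp_assoc[OF q'(2) px(3) l'(2)] dm(3)[symmetric] comp_assoc[OF q'(2) dm(1) px(3), symmetric] q'(3))
    qed
    obtain u where u: "u \<in> hom C M L" "\<And>n. u \<cdot> p n = q n \<cdot> Fst P (x n) (x' n)"
      using ex1_implies_ex[OF omega_limit_lift[OF L c]] by blast
    obtain v where v: "v \<in> hom C M L'" "\<And>n. v \<cdot> p' n = q n \<cdot> Snd P (x n) (x' n)"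
      using ex1_implies_ex[OF omega_limit_lift[OF L' c']] by blast
    obtain m where m: "m \<in> hom C M (PObj P L L')" "m \<cdot> Fst P L L' = u" "m \<cdot> Snd P L L' = v"
      using ex1_implies_ex[OF prod_pair[OF u(1) v(1)]] by blast
    have "m \<cdot> prod_map C P (p n) (p' n) = q n" for n
    proof (rule prod_eqI[OF l(1) l'(1) comp_hom[OF m(1) pm(1)] q'(2)])
      show "m \<cdot> prod_map C P (p n) (p' n) \<cdot> Fst P (x n) (x' n) = q n \<cdot> Fst P (x n) (x' n)"
        by (simp add: comp_assoc[OF m(1) pm(1) px(2)] pm(2) comp_assoc[OF m(1) pl(2) l(4), symmetric] m(2) u(2))
      show "m \<cdot> prod_map C P (p n) (p' n) \<cdot> Snd P (x n) (x' n) = q n \<cdot> Snd P (x n) (x' n)"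
        by (simp add: comp_assoc[OF m(1) pm(1) px(3)] pm(3) comp_assoc[OF m(1) pl(3) l'(4), symmetric] m(3) v(2))
    qed
    with m(1) show "\<exists>m. m \<in> hom C M (PObj P L L') \<and> (\<forall>n. m \<cdot> prod_map C P (p n) (p' n) = q n)" by blast
  next
    fix m m'
    assume "m \<in> hom C M (PObj P L L') \<and> (\<forall>n. m \<cdot> prod_map C P (p n) (p' n) = q n)"
      "m' \<in> hom C M (PObj P L L') \<and> (\<forall>n. m' \<cdot> prod_map C P (p n) (p' n) = q n)"
    then have m: "m \<in> hom C M (PObj P L L')" "m' \<in> hom C M (PObj P L L')"
      and eq: "\<And>n. m \<cdot> prod_map C P (p n) (p' n) = m' \<cdot> prod_map C P (p n) (p' n)"
      by simp_all
    show "m = m'"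
    proof (rule prod_eqI[OF l(3) l'(3) m])
      \<comment> \<open>The projection of \<open>m\<close> to \<open>L\<close> is determined by its
        composites with the legs \<open>p n\<close>, and these are projections of
        \<open>m \<cdot> prod_map C P (p n) (p' n)\<close>.\<close>
      show "m \<cdot> Fst P L L' = m' \<cdot> Fst P L L'"
      proof (rule omega_limit_eqI[OF L comp_hom[OF m(1) pl(2)] comp_hom[OF m(2) pl(2)]])
        show "m \<cdot> Fst P L L' \<cdot> p n = m' \<cdot> Fst P L L' \<cdot> p n" for n
          by (simp add: comp_assoc[OF m(1) pl(2) l(4)] comp_assoc[OF m(2) pl(2) l(4)] pm(2)[symmetric])
            (simp add: comp_assoc[OF m(1) pm(1) px(2), symmetric] comp_assoc[OF m(2) pm(1) px(2), symmetric] eq)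
      qed
      show "m \<cdot> Snd P L L' = m' \<cdot> Snd P L L'"
      proof (rule omega_limit_eqI[OF L' comp_hom[OF m(1) pl(3)] comp_hom[OF m(2) pl(3)]])
        show "m \<cdot> Snd P L L' \<cdot> p' n = m' \<cdot> Snd P L L' \<cdot> p' n" for n
          by (simp add: comp_assoc[OF m(1) pl(3) l'(4)] comp_assoc[OF m(2) pl(3) l'(4)] pm(3)[symmetric])
            (simp add: comp_assoc[OF m(1) pm(1) px(3), symmetric] comp_assoc[OF m(2) pm(1) px(3), symmetric] eq)
      qed
    qed
  qed
  then show ?thesis
    using cochain cone unfolding omega_limit_def by simp
qed

lemma omega_continuous_prod:
  assumes "category A" "category_with_products B P"
    and F: "omega_continuous A B F" and G: "omega_continuous A B G"
  shows "omega_continuous A B (prod_functor A B P F G)"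
  unfolding omega_continuous_def
proof (intro conjI allI impI is_functor_prod[OF assms(1,2) F[THEN omega_continuous_functor] G[THEN omega_continuous_functor]])
  interpret B: category_with_products B P by fact
  fix x d L p assume L: "omega_limit A x d L p"
  note l = omega_limit_facts[OF L]
  show "omega_limit B (\<lambda>n. FOb (prod_functor A B P F G) (x n)) (\<lambda>n. FArr (prod_functor A B P F G) (d n))
      (FOb (prod_functor A B P F G) L) (\<lambda>n. FArr (prod_functor A B P F G) (p n))"
    using B.omega_limit_prod[OF omega_continuous_limit[OF F L] omega_continuous_limit[OF G L]] l
    by (simp add: prod_functor_simps(1) prod_functor_simps(2)[OF l(2)] prod_functor_simps(2)[OF l(4)])
qed


subsection \<open>Coproducts of continuous functors\<close>

text \<open>The form in which distributivity is used: for chosen coproducts, a coproduct of limiting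
  cones is limiting. No comparison arrow is mentioned, so it can be verified componentwise in a
  functor category.\<close>

definition coproducts_preserve_omega_limits ::
    "('o, 'm) cat \<Rightarrow> ('j, 'o, 'm) coprods \<Rightarrow> 'j set \<Rightarrow> bool" where
  "coproducts_preserve_omega_limits C K J \<longleftrightarrow>
     (\<forall>x d L p. (\<forall>j\<in>J. omega_limit C (x j) (d j) (L j) (p j)) \<longrightarrow>
        omega_limit C (\<lambda>n. Coprod K J (\<lambda>j\<in>J. x j n)) (\<lambda>n. coprod_map C K J (\<lambda>j. d j n))
          (Coprod K J (restrict L J)) (\<lambda>n. coprod_map C K J (\<lambda>j. p j n)))"

context category_with_coproducts
begin

lemma cochain_coprod:
  assumes "\<forall>j\<in>J. omega_limit C (x j) (d j) (L j) (p j)"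
  shows "cochain C (\<lambda>n. Coprod K J (\<lambda>j\<in>J. x j n)) (\<lambda>n. coprod_map C K J (\<lambda>j. d j n))"
  using omega_limit_facts[OF bspec[OF assms]] unfolding cochain_def
  by (intro allI conjI coprod_ob coprod_map_hom) simp_all

lemma omega_cone_coprod:
  assumes "\<forall>j\<in>J. omega_limit C (x j) (d j) (L j) (p j)"
  shows "omega_cone C (\<lambda>n. Coprod K J (\<lambda>j\<in>J. x j n)) (\<lambda>n. coprod_map C K J (\<lambda>j. d j n))
    (Coprod K J (restrict L J)) (\<lambda>n. coprod_map C K J (\<lambda>j. p j n))"
proof (rule omega_coneI)
  note l = omega_limit_facts[OF bspec[OF assms]]
  show "coprod_map C K J (\<lambda>j. p j n) \<in> hom C (Coprod K J (restrict L J)) (Coprod K J (\<lambda>j\<in>J. x j n))" for n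
    by (rule coprod_map_hom) (simp add: l(4))
  show "coprod_map C K J (\<lambda>j. p j (Suc n)) \<cdot> coprod_map C K J (\<lambda>j. d j n) = coprod_map C K J (\<lambda>j. p j n)" for n
  proof -
    have "coprod_map C K J (\<lambda>j. p j (Suc n) \<cdot> d j n) =
        coprod_map C K J (\<lambda>j. p j (Suc n)) \<cdot> coprod_map C K J (\<lambda>j. d j n)"
      by (rule coprod_map_comp[where x = L and y = "\<lambda>j. x j (Suc n)" and z = "\<lambda>j. x j n"]) (simp_all add: l(2,4))
    moreover have "coprod_map C K J (\<lambda>j. p j (Suc n) \<cdot> d j n) = coprod_map C K J (\<lambda>j. p j n)"
      by (rule coprod_map_cong) (simp add: l(5))
    ultimately show ?thesis by simp
  qed
qed

text \<open>The cochain of coproducts has some limit \<open>M\<close>. By distributivity the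
  coproduct of the limits is isomorphic to \<open>M\<close>, compatibly with the legs, hence a limit
  itself.\<close>

lemma coproducts_preserve_omega_limitsI:
  assumes lims: "has_omega_limits C" and dist: "omega_limits_distribute C J"
  shows "coproducts_preserve_omega_limits C K J"
  unfolding coproducts_preserve_omega_limits_def
proof (intro allI impI)
  fix x d L p assume L: "\<forall>j\<in>J. omega_limit C (x j) (d j) (L j) (p j)"
  let ?c = "\<lambda>n. Coprod K J (\<lambda>j\<in>J. x j n)" and ?e = "\<lambda>n. coprod_map C K J (\<lambda>j. d j n)"
    and ?Q = "Coprod K J (restrict L J)" and ?p = "\<lambda>n. coprod_map C K J (\<lambda>j. p j n)"
    and ?\<iota> = "Inj K J (restrict L J)" and ?\<kappa> = "\<lambda>n. Inj K J (\<lambda>j\<in>J. x j n)"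
  note l = omega_limit_facts[OF bspec[OF L]]
  have L_ob: "\<forall>j\<in>J. L j \<in> Ob C" using l(3) by blast
  have d: "\<forall>j\<in>J. d j n \<in> hom C (x j (Suc n)) (x j n)" and p: "\<forall>j\<in>J. p j n \<in> hom C (L j) (x j n)" for n
    using l(2,4) by simp_all
  obtain M q where M: "omega_limit C ?c ?e M q"
    using lims cochain_coprod[OF L] unfolding has_omega_limits_def by blast
  note q = omega_limit_facts(4)[OF M]
  obtain m where m: "m \<in> hom C ?Q M" "\<And>n. m \<cdot> q n = ?p n"
    using ex1_implies_ex[OF omega_limit_lift[OF M omega_cone_coprod[OF L]]] by blast
  \<comment> \<open>Being a coproduct only looks at the family on \<open>J\<close>;
    \<open>omega_limits_distribute\<close> is phrased with unrestricted families.\<close>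
  have restrict: "is_coproduct C J y c \<iota>" if "is_coproduct C J (restrict y J) c \<iota>" for y c \<iota>
    using that by (simp add: is_coproduct_def)
  have Q: "is_coproduct C J L ?Q ?\<iota>"
    by (rule restrict[OF is_coproduct_restrict[OF L_ob]])
  have c: "\<forall>n. is_coproduct C J (\<lambda>j. x j n) (?c n) (?\<kappa> n)"
    by (rule allI, rule restrict, rule is_coproduct_restrict) (simp add: l(1))
  have e: "\<forall>n. ?e n \<in> hom C (?c (Suc n)) (?c n) \<and> (\<forall>j\<in>J. ?\<kappa> (Suc n) j \<cdot> ?e n = d j n \<cdot> ?\<kappa> n j)"
    using coprod_map[OF d] by simp
  \<comment> \<open>These equations identify the lift \<open>m\<close> as the canonical arrow of the
    distributivity condition.\<close>
  have \<iota>m: "\<forall>j\<in>J. \<forall>n. ?\<iota> j \<cdot> m \<cdot> q n = p j n \<cdot> ?\<kappa> n j"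
    using comp_assoc[OF inj_hom[OF L_ob] m(1) q] inj_coprod_map[OF p] m(2) by simp
  \<comment> \<open>Spelling out the instance lets unification find all the instantiations.\<close>
  from dist have "(\<forall>j\<in>J. omega_limit C (x j) (d j) (L j) (p j)) \<longrightarrow> is_coproduct C J L ?Q ?\<iota> \<longrightarrow>
      (\<forall>n. is_coproduct C J (\<lambda>j. x j n) (?c n) (?\<kappa> n)) \<longrightarrow>
      (\<forall>n. ?e n \<in> hom C (?c (Suc n)) (?c n) \<and> (\<forall>j\<in>J. ?\<kappa> (Suc n) j \<cdot> ?e n = d j n \<cdot> ?\<kappa> n j)) \<longrightarrow>
      omega_limit C ?c ?e M q \<longrightarrow> m \<in> hom C ?Q M \<longrightarrow>
      (\<forall>j\<in>J. \<forall>n. ?\<iota> j \<cdot> m \<cdot> q n = p j n \<cdot> ?\<kappa> n j) \<longrightarrow> is_iso C m"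
    unfolding omega_limits_distribute_def by (elim allE)
  then have "is_iso C m"
    using L Q c e M m(1) \<iota>m by simp
  from omega_limit_iso[OF M m(1) this] show "omega_limit C ?c ?e ?Q ?p"
    unfolding m(2) .
qed

end

text \<open>At each object the claim is the hypothesis on \<open>B\<close>, because limits,
  coproducts and coproduct maps in [A, B] all have the expected components. It is made to be
  iterated.\<close>

lemma coproducts_preserve_omega_limits_functor_cat:
  assumes "category A" "category_with_coproducts B K J" "has_omega_limits B"
    and pres: "coproducts_preserve_omega_limits B K J"
  shows "coproducts_preserve_omega_limits (functor_cat A B) (pointwise_coprods A B K) J"
  unfolding coproducts_preserve_omega_limits_def
proof (intro allI impI)
  interpret B: category_with_coproducts B K J by fact
  interpret AB: category_with_coproducts "functor_cat A B" "pointwise_coprods A B K" J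
    by (rule coproducts_functor_cat) fact+
  fix x d L p assume L: "\<forall>j\<in>J. omega_limit (functor_cat A B) (x j) (d j) (L j) (p j)"
  let ?K = "pointwise_coprods A B K"
  note l = omega_limit_facts[OF bspec[OF L]]
  show "omega_limit (functor_cat A B) (\<lambda>n. Coprod ?K J (\<lambda>j\<in>J. x j n)) (\<lambda>n. coprod_map (functor_cat A B) ?K J (\<lambda>j. d j n))
     (Coprod ?K J (restrict L J)) (\<lambda>n. coprod_map (functor_cat A B) ?K J (\<lambda>j. p j n))"
  proof (rule omega_limit_pointwiseI[OF assms(1) B.category_axioms AB.cochain_coprod[OF L] AB.omega_cone_coprod[OF L]])
    fix a assume a: "a \<in> Ob A"
    have ob: "FOb (Coprod ?K J (restrict F J)) a = Coprod K J (\<lambda>j\<in>J. FOb (F j) a)" for F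
      using a by (simp add: pointwise_coprods_def coprod_functor_simps cong: restrict_cong)
    have arr: "NMap (coprod_map (functor_cat A B) ?K J (\<lambda>j. d j n)) a = coprod_map B K J (\<lambda>j. NMap (d j n) a)"
      "NMap (coprod_map (functor_cat A B) ?K J (\<lambda>j. p j n)) a = coprod_map B K J (\<lambda>j. NMap (p j n) a)" for n
      using l(2,4) by (auto intro!: NMap_coprod_map[OF assms(1,2) _ a])
    have "\<forall>j\<in>J. omega_limit B (\<lambda>n. FOb (x j n) a) (\<lambda>n. NMap (d j n) a) (FOb (L j) a) (\<lambda>n. NMap (p j n) a)"
      using omega_limit_component[OF assms(1) B.category_axioms assms(3) bspec[OF L] a] by blast
    from pres[unfolded coproducts_preserve_omega_limits_def, rule_format, OF this[rule_format]]
    show "omega_limit B (\<lambda>n. FOb (Coprod ?K J (\<lambda>j\<in>J. x j n)) a)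
        (\<lambda>n. NMap (coprod_map (functor_cat A B) ?K J (\<lambda>j. d j n)) a) (FOb (Coprod ?K J (restrict L J)) a)
        (\<lambda>n. NMap (coprod_map (functor_cat A B) ?K J (\<lambda>j. p j n)) a)"
      unfolding ob arr .
  qed
qed

lemma omega_continuous_coprod:
  assumes "category A" "category_with_coproducts B K J"
    and pres: "coproducts_preserve_omega_limits B K J"
    and F: "\<And>j. j \<in> J \<Longrightarrow> omega_continuous A B (F j)"
  shows "omega_continuous A B (coprod_functor A B K J F)"
  unfolding omega_continuous_def
proof (intro conjI allI impI is_functor_coprod[OF assms(1,2)])
  show "is_functor A B (F j)" if "j \<in> J" for j by (rule omega_continuous_functor[OF F[OF that]])
  fix x d L p assume L: "omega_limit A x d L p"
  note l = omega_limit_facts[OF L]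
  have "\<forall>j\<in>J. omega_limit B (\<lambda>n. FOb (F j) (x n)) (\<lambda>n. FArr (F j) (d n)) (FOb (F j) L) (\<lambda>n. FArr (F j) (p n))"
    using omega_continuous_limit[OF F L] by blast
  from pres[unfolded coproducts_preserve_omega_limits_def, rule_format, OF this[rule_format]]
  show "omega_limit B (\<lambda>n. FOb (coprod_functor A B K J F) (x n)) (\<lambda>n. FArr (coprod_functor A B K J F) (d n))
      (FOb (coprod_functor A B K J F) L) (\<lambda>n. FArr (coprod_functor A B K J F) (p n))"
    by (simp add: coprod_functor_simps(1)[OF l(1)] coprod_functor_simps(1)[OF l(3)]
        coprod_functor_simps(2)[OF l(2)] coprod_functor_simps(2)[OF l(4)])
qed


section \<open>Final coalgebras of continuous functors\<close>

text \<open>A naturality square for arrows into \<open>T\<close> ends in \<open>T\<close>, so it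
  commutes by uniqueness.\<close>

lemma is_terminal_functor_cat:
  assumes "category A" "category B" "is_terminal B T"
  shows "is_terminal (functor_cat A B) (const_functor A B T)"
  unfolding is_terminal_def
proof (intro conjI ballI)
  interpret A: category A by fact
  interpret B: category B by fact
  have T: "T \<in> Ob B" and uniq: "\<And>b. b \<in> Ob B \<Longrightarrow> \<exists>!f. f \<in> hom B b T"
    using assms(3) by (simp_all add: is_terminal_def)
  have eq: "f = g" if "f \<in> hom B b T" "g \<in> hom B b T" for f g b
    using uniq[OF B.hom_ob(1)[OF that(1)]] that by blast
  note K = is_functor_const[OF assms(1,2) T]
  then show "const_functor A B T \<in> Ob (functor_cat A B)" by simp
  fix F assume "F \<in> Ob (functor_cat A B)"
  then have F: "is_functor A B F" by simp
  show "\<exists>!\<alpha>. \<alpha> \<in> hom (functor_cat A B) F (const_functor A B T)"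
  proof (rule ex_ex1I)
    define \<eta> where "\<eta> a = (THE f. f \<in> hom B (FOb F a) T)" for a
    have \<eta>: "\<eta> a \<in> hom B (FOb F a) T" if "a \<in> Ob A" for a
      unfolding \<eta>_def by (rule theI'[OF uniq[OF functor_ob[OF F that]]])
    have "\<lparr> NDom = F, NCod = const_functor A B T, NMap = restrict \<eta> (Ob A) \<rparr>
        \<in> hom (functor_cat A B) F (const_functor A B T)"
    proof (rule homI_functor_cat[OF assms(1) F K])
      show "\<eta> a \<in> hom B (FOb F a) (FOb (const_functor A B T) a)" if "a \<in> Ob A" for a
        using \<eta>[OF that] that by simp
      show "FArr F f \<cdot>\<^bsub>B\<^esub> \<eta> b = \<eta> a \<cdot>\<^bsub>B\<^esub> FArr (const_functor A B T) f" if f: "f \<in> hom A a b" for f a b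
        unfolding const_functor_simps(2)[OF f]
        by (rule eq[OF B.comp_hom[OF functor_hom[OF F f] \<eta>] B.comp_hom[OF \<eta> B.id_hom[OF T]]])
          (rule A.hom_ob[OF f])+
    qed
    then show "\<exists>\<alpha>. \<alpha> \<in> hom (functor_cat A B) F (const_functor A B T)" by blast
  next
    fix \<alpha> \<beta> assume \<alpha>: "\<alpha> \<in> hom (functor_cat A B) F (const_functor A B T)"
      and \<beta>: "\<beta> \<in> hom (functor_cat A B) F (const_functor A B T)"
    show "\<alpha> = \<beta>"
    proof (rule ntrans_ext[OF \<alpha> \<beta>])
      fix a assume "a \<in> Ob A"
      then show "NMap \<alpha> a = NMap \<beta> a"
        using ntrans_component[OF \<alpha>, of a] ntrans_component[OF \<beta>, of a] by (intro eq) simp_all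
    qed
  qed
qed

text \<open>Adamek's theorem: the limit \<open>Z\<close> of \<open>T \<leftarrow> F T \<leftarrow> F (F T) \<leftarrow> \<cdots>\<close> maps to \<open>F Z\<close>, because \<open>F Z\<close> is a
  limit of the same cochain without its first member. A coalgebra \<open>c : X \<rightarrow> F X\<close> determines a cone
  on the cochain by \<open>h (n + 1) = c \<cdot> F (h n)\<close>, and its lifting to \<open>Z\<close> is the coalgebra morphism.\<close>

theorem (in category) omega_continuous_final_coalgebra:
  assumes T: "is_terminal C T" and lims: "has_omega_limits C" and cont: "omega_continuous C C F"
  shows "\<exists>Z z. final_coalgebra C F Z z"
proof -
  note F = omega_continuous_functor[OF cont]
  note Fhom = functor_hom[OF F]
  have T_ob: "T \<in> Ob C" and uniq: "\<And>a. a \<in> Ob C \<Longrightarrow> \<exists>!f. f \<in> hom C a T"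
    using T by (simp_all add: is_terminal_def)
  define bang where "bang a = (THE f. f \<in> hom C a T)" for a
  have bang: "bang a \<in> hom C a T" if "a \<in> Ob C" for a
    unfolding bang_def by (rule theI'[OF uniq[OF that]])
  have bang_eq: "f = bang a" if "f \<in> hom C a T" for f a
    using uniq[OF hom_ob(1)[OF that]] bang[OF hom_ob(1)[OF that]] that by blast
  define x where "x n = (FOb F ^^ n) T" for n
  define d where "d n = (FArr F ^^ n) (bang (FOb F T))" for n
  have x: "x 0 = T" "x (Suc n) = FOb F (x n)" for n by (simp_all add: x_def)
  have d: "d 0 = bang (FOb F T)" "d (Suc n) = FArr F (d n)" for n by (simp_all add: d_def)
  have x_ob: "x n \<in> Ob C" for n
    by (induction n) (simp_all add: x T_ob functor_ob[OF F])
  have d_hom: "d n \<in> hom C (x (Suc n)) (x n)" for n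
    by (induction n) (simp_all add: x d bang functor_ob[OF F T_ob] Fhom)
  have "cochain C x d" using x_ob d_hom by (simp add: cochain_def)
  then obtain Z p where Z: "omega_limit C x d Z p"
    using lims unfolding has_omega_limits_def by blast
  note l = omega_limit_facts[OF Z]
  note FZ = omega_continuous_limit[OF cont Z]
  note Fp = omega_limit_facts(4)[OF FZ]
  \<comment> \<open>Shift by one: \<open>FOb F (x n)\<close> is \<open>x (Suc n)\<close> and
    \<open>FArr F (d n)\<close> is \<open>d (Suc n)\<close>, so dropping \<open>p 0\<close> leaves a
    cone on the cochain with limit \<open>FOb F Z\<close>.\<close>
  have "omega_cone C (\<lambda>n. FOb F (x n)) (\<lambda>n. FArr F (d n)) Z (\<lambda>n. p (Suc n))"
    using l(4)[of "Suc _"] l(5)[of "Suc _"] by (intro omega_coneI) (simp_all add: x d)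
  from ex1_implies_ex[OF omega_limit_lift[OF FZ this]]
  obtain z where z: "z \<in> hom C Z (FOb F Z)" "\<And>n. z \<cdot> FArr F (p n) = p (Suc n)"
    by blast
  have "\<exists>!h. h \<in> hom C X Z \<and> c \<cdot> FArr F h = h \<cdot> z" if "coalgebra C F X c" for X c
  proof -
    from that have X: "X \<in> Ob C" and c: "c \<in> hom C X (FOb F X)" by (simp_all add: coalgebra_def)
    define h where "h = rec_nat (bang X) (\<lambda>_ g. c \<cdot> FArr F g)"
    have h: "h 0 = bang X" "h (Suc n) = c \<cdot> FArr F (h n)" for n by (simp_all add: h_def)
    have h_hom: "h n \<in> hom C X (x n)" for n
      by (induction n) (simp_all add: h x bang X comp_hom[OF c Fhom])
    \<comment> \<open>At 0 both sides are arrows into \<open>T\<close>; the step applies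
      \<open>F\<close> to the previous equation and precomposes with \<open>c\<close>.\<close>
    have h_cone: "h (Suc n) \<cdot> d n = h n" for n
    proof (induction n)
      case 0
      show ?case using bang_eq[OF comp_hom[OF h_hom[of "Suc 0"] d_hom[of 0, unfolded x(1)]]] by (simp add: h(1))
    next
      case (Suc n)
      have "c \<cdot> FArr F (h (Suc n)) \<cdot> FArr F (d n) = c \<cdot> FArr F (h n)"
        using comp_assoc[OF c Fhom[OF h_hom] Fhom[OF d_hom]] functor_comp[OF F h_hom d_hom, symmetric] Suc
        by simp
      then show ?case by (simp add: h(2) d(2))
    qed
    have "omega_cone C x d X h"
      by (rule omega_coneI) (rule h_hom h_cone)+
    from ex1_implies_ex[OF omega_limit_lift[OF Z this]]
    obtain k where k: "k \<in> hom C X Z" "\<And>n. k \<cdot> p n = h n"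
      by blast
    have cFp: "c \<cdot> FArr F g \<cdot> FArr F (p n) = c \<cdot> FArr F (g \<cdot> p n)" if "g \<in> hom C X Z" for g n
      using comp_assoc[OF c Fhom[OF that] Fp] functor_comp[OF F that l(4)] by simp
    have gzp: "g \<cdot> z \<cdot> FArr F (p n) = g \<cdot> p (Suc n)" if "g \<in> hom C X Z" for g n
      using comp_assoc[OF that z(1) Fp] z(2) by simp
    show ?thesis
    proof (rule ex1I[of _ k])
      \<comment> \<open>Composed with the legs \<open>FArr F (p n)\<close> of
        \<open>FOb F Z\<close>, both sides become \<open>h (Suc n)\<close>.\<close>
      have "c \<cdot> FArr F k = k \<cdot> z"
        by (rule omega_limit_eqI[OF FZ comp_hom[OF c Fhom[OF k(1)]] comp_hom[OF k(1) z(1)]])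
          (simp add: cFp[OF k(1)] gzp[OF k(1)] k(2) h(2))
      with k(1) show "k \<in> hom C X Z \<and> c \<cdot> FArr F k = k \<cdot> z" by simp
    next
      fix g assume "g \<in> hom C X Z \<and> c \<cdot> FArr F g = g \<cdot> z"
      then have g: "g \<in> hom C X Z" and gz: "c \<cdot> FArr F g = g \<cdot> z" by simp_all
      \<comment> \<open>A coalgebra morphism obeys the recursion that defines \<open>h\<close>, so
        its composites with the legs are forced.\<close>
      have "g \<cdot> p n = h n" for n
      proof (induction n)
        case 0
        show ?case using bang_eq[OF comp_hom[OF g l(4)[of 0, unfolded x(1)]]] by (simp add: h(1))
      next
        case (Suc n)
        then show ?case using cFp[OF g, of n] gzp[OF g, of n] gz by (simp add: h(2))
      qed
      then show "g = k" by (intro omega_limit_eqI[OF Z g k(1)]) (simp add: k(2))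
    qed
  qed
  then have "final_coalgebra C F Z z"
    using l(3) z(1) by (simp add: final_coalgebra_def coalgebra_def)
  then show ?thesis by blast
qed


section \<open>Signature functors\<close>

lemma is_functor_hat_obj:
  assumes "\<And>u. u \<in> S \<Longrightarrow> category_with_coproducts C K (eq_proofs s u)"
    and "category C" "c \<in> Ob C"
  shows "is_functor (discrete S) C (hat_obj C K S s c)"
proof (rule is_functorI)
  interpret category C by fact
  let ?h = "\<lambda>t. Coprod K (eq_proofs s t) (\<lambda>_\<in>eq_proofs s t. c)"
  have ob: "FOb (hat_obj C K S s c) t = ?h t" and arr: "FArr (hat_obj C K S s c) t = Ident C (?h t)"
    if "t \<in> S" for t
    using that by (simp_all add: hat_obj_def Let_def)
  have h: "?h t \<in> Ob C" if "t \<in> S" for t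
    using category_with_coproducts.coprod_ob[OF assms(1)[OF that], of "\<lambda>_. c"] assms(3) by simp
  show "FOb (hat_obj C K S s c) t \<in> Ob C" if "t \<in> Ob (discrete S)" for t
    using that h by (simp add: ob)
  show "FArr (hat_obj C K S s c) f \<in> hom C (FOb (hat_obj C K S s c) a) (FOb (hat_obj C K S s c) b)"
    if "f \<in> hom (discrete S) a b" for f a b
    using that id_hom[OF h] by (auto simp: hom_discrete ob arr)
  show "FArr (hat_obj C K S s c) (Ident (discrete S) a) = Ident C (FOb (hat_obj C K S s c) a)"
    if "a \<in> Ob (discrete S)" for a
    using that by (simp add: ob arr discrete_def)
  show "FArr (hat_obj C K S s c) (f \<cdot>\<^bsub>discrete S\<^esub> g) =
      FArr (hat_obj C K S s c) f \<cdot>\<^bsub>C\<^esub> FArr (hat_obj C K S s c) g"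
    if "f \<in> hom (discrete S) a b" "g \<in> hom (discrete S) b c'" for f g a b c'
  proof -
    from that have "f = a" "g = a" "a \<in> S" by (auto simp: hom_discrete)
    moreover have "a \<cdot>\<^bsub>discrete S\<^esub> a = a" by (simp add: discrete_def)
    ultimately show ?thesis using comp_id[OF id_hom[OF h]] by (simp add: arr)
  qed
qed (auto simp: hat_obj_def Let_def discrete_def)

lemma hat_functor_simps:
  "c \<in> Ob C \<Longrightarrow> FOb (hat_functor C K S s) c = hat_obj C K S s c"
  "f \<in> hom C a b \<Longrightarrow> FArr (hat_functor C K S s) f =
    \<lparr> NDom = hat_obj C K S s a, NCod = hat_obj C K S s b,
      NMap = (\<lambda>t\<in>S. coprod_map C K (eq_proofs s t) (\<lambda>_. f)) \<rparr>"
  using homD[of f C a b] by (simp_all add: hat_functor_def)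

lemma is_functor_hat:
  assumes "category C"
    and K: "\<And>u. u \<in> S \<Longrightarrow> category_with_coproducts C K (eq_proofs s u)"
  shows "is_functor C (power_cat C S) (hat_functor C K S s)"
proof (rule is_functorI)
  interpret category C by fact
  interpret CS: category "power_cat C S" by (rule category_power_cat) fact
  note obj = is_functor_hat_obj[OF K assms(1)]
  have ob: "FOb (hat_obj C K S s c) t = Coprod K (eq_proofs s t) (\<lambda>_\<in>eq_proofs s t. c)"
    and arr: "FArr (hat_obj C K S s c) t = Ident C (Coprod K (eq_proofs s t) (\<lambda>_\<in>eq_proofs s t. c))"
    if "t \<in> S" for t c
    using that by (simp_all add: hat_obj_def Let_def)
  show obj': "FOb (hat_functor C K S s) c \<in> Ob (power_cat C S)" if "c \<in> Ob C" for c
    using obj[OF _ that] that by (simp add: hat_functor_simps)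
  show hom: "FArr (hat_functor C K S s) f \<in> hom (power_cat C S) (FOb (hat_functor C K S s) a) (FOb (hat_functor C K S s) b)"
    if f: "f \<in> hom C a b" for f a b
  proof -
    note ab = hom_ob[OF f]
    have cm: "coprod_map C K (eq_proofs s t) (\<lambda>_. f) \<in>
        hom C (Coprod K (eq_proofs s t) (\<lambda>_\<in>eq_proofs s t. a)) (Coprod K (eq_proofs s t) (\<lambda>_\<in>eq_proofs s t. b))"
      if "t \<in> S" for t
      by (rule category_with_coproducts.coprod_map_hom[OF K[OF that]]) (simp add: f)
    have "\<lparr> NDom = hat_obj C K S s a, NCod = hat_obj C K S s b,
        NMap = (\<lambda>t\<in>Ob (discrete S). coprod_map C K (eq_proofs s t) (\<lambda>_. f)) \<rparr>
      \<in> hom (power_cat C S) (hat_obj C K S s a) (hat_obj C K S s b)"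
    proof (rule homI_functor_cat[OF category_discrete obj[OF _ ab(1)] obj[OF _ ab(2)]])
      fix g t u assume "g \<in> hom (discrete S) t u"
      \<comment> \<open>A discrete category has only identities, so naturality reduces to the unit
        laws.\<close>
      then have "g = t" "u = t" "t \<in> S" by (auto simp: hom_discrete)
      then show "FArr (hat_obj C K S s a) g \<cdot>\<^bsub>C\<^esub> coprod_map C K (eq_proofs s u) (\<lambda>_. f) =
          coprod_map C K (eq_proofs s t) (\<lambda>_. f) \<cdot>\<^bsub>C\<^esub> FArr (hat_obj C K S s b) g"
        using id_comp[OF cm] comp_id[OF cm] by (simp add: arr)
    qed (use cm in \<open>simp_all add: ob\<close>)
    then show ?thesis
      by (simp add: hat_functor_simps(1)[OF ab(1)] hat_functor_simps(1)[OF ab(2)] hat_functor_simps(2)[OF f])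
  qed
  show "FArr (hat_functor C K S s) (Ident C c) = Ident (power_cat C S) (FOb (hat_functor C K S s) c)"
    if c: "c \<in> Ob C" for c
  proof (rule ntrans_ext[OF hom[OF id_hom[OF c]] CS.id_hom[OF obj'[OF c]]])
    fix t assume "t \<in> Ob (discrete S)"
    then show "NMap (FArr (hat_functor C K S s) (Ident C c)) t =
        NMap (Ident (power_cat C S) (FOb (hat_functor C K S s) c)) t"
      using category_with_coproducts.coprod_map_Ident[OF K, of t "\<lambda>_. c"] c
      by (simp add: hat_functor_simps(1) hat_functor_simps(2)[OF id_hom[OF c]] ob)
  qed
  show "FArr (hat_functor C K S s) (f \<cdot>\<^bsub>C\<^esub> g) =
      FArr (hat_functor C K S s) f \<cdot>\<^bsub>power_cat C S\<^esub> FArr (hat_functor C K S s) g"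
    if f: "f \<in> hom C a b" and g: "g \<in> hom C b c" for f g a b c
  proof (rule ntrans_ext[OF hom[OF comp_hom[OF f g]] CS.comp_hom[OF hom[OF f] hom[OF g]]])
    fix t assume t: "t \<in> Ob (discrete S)"
    then have "coprod_map C K (eq_proofs s t) (\<lambda>_. f \<cdot>\<^bsub>C\<^esub> g) =
        coprod_map C K (eq_proofs s t) (\<lambda>_. f) \<cdot>\<^bsub>C\<^esub> coprod_map C K (eq_proofs s t) (\<lambda>_. g)"
      by (intro category_with_coproducts.coprod_map_comp[OF K, where x = "\<lambda>_. a" and y = "\<lambda>_. b" and z = "\<lambda>_. c"])
        (simp_all add: f g)
    with t show "NMap (FArr (hat_functor C K S s) (f \<cdot>\<^bsub>C\<^esub> g)) t =
        NMap (FArr (hat_functor C K S s) f \<cdot>\<^bsub>power_cat C S\<^esub> FArr (hat_functor C K S s) g) t"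
      by (simp add: hat_functor_simps(2)[OF f] hat_functor_simps(2)[OF g] hat_functor_simps(2)[OF comp_hom[OF f g]])
  qed
qed (auto simp: hat_functor_def)

text \<open>Evaluated at a sort \<open>t\<close>, the claim is preservation of limits by coproducts
  over \<open>eq_proofs s t\<close>, for families that do not depend on the index.\<close>

lemma omega_continuous_hat:
  assumes "category C"
    and K: "\<And>u. u \<in> S \<Longrightarrow> category_with_coproducts C K (eq_proofs s u)"
    and pres: "\<And>u. u \<in> S \<Longrightarrow> coproducts_preserve_omega_limits C K (eq_proofs s u)"
  shows "omega_continuous C (power_cat C S) (hat_functor C K S s)" (is "omega_continuous _ _ ?F")
  unfolding omega_continuous_def
proof (intro conjI allI impI)
  show F: "is_functor C (power_cat C S) ?F"
    by (rule is_functor_hat[OF assms(1) K])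
  fix x d L p assume L: "omega_limit C x d L p"
  note l = omega_limit_facts[OF L]
  show "omega_limit (power_cat C S) (\<lambda>n. FOb ?F (x n)) (\<lambda>n. FArr ?F (d n)) (FOb ?F L) (\<lambda>n. FArr ?F (p n))"
  proof (rule omega_limit_pointwiseI[OF category_discrete assms(1) cochain_functor[OF F omega_limit_cochain[OF L]]
        omega_cone_functor[OF category_power_cat[OF assms(1)] F omega_limit_cochain[OF L] omega_limit_cone[OF L]]])
    fix t assume "t \<in> Ob (discrete S)"
    then have t: "t \<in> S" by simp
    have ob: "FOb (FOb ?F c) t = Coprod K (eq_proofs s t) (\<lambda>_\<in>eq_proofs s t. c)" if "c \<in> Ob C" for c
      using t that by (simp add: hat_functor_simps hat_obj_def Let_def)
    have arr: "NMap (FArr ?F f) t = coprod_map C K (eq_proofs s t) (\<lambda>_. f)" if "f \<in> hom C a b" for f a b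
      using t by (simp add: hat_functor_simps(2)[OF that])
    \<comment> \<open>Preservation is instantiated with cochains and cones constant in the index of
      the coproduct.\<close>
    from pres[OF t, unfolded coproducts_preserve_omega_limits_def, THEN spec[where x = "\<lambda>_. x"],
        THEN spec[where x = "\<lambda>_. d"], THEN spec[where x = "\<lambda>_. L"], THEN spec[where x = "\<lambda>_. p"]] L
    show "omega_limit C (\<lambda>n. FOb (FOb ?F (x n)) t) (\<lambda>n. NMap (FArr ?F (d n)) t) (FOb (FOb ?F L) t)
        (\<lambda>n. NMap (FArr ?F (p n)) t)"
      unfolding ob[OF l(1)] ob[OF l(3)] arr[OF l(2)] arr[OF l(4)] by simp
  qed
qed

lemma proj_functor_simps:
  "\<xi> \<in> Ob (power_cat C S) \<Longrightarrow> FOb (proj_functor C S s) \<xi> = FOb \<xi> s"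
  "\<alpha> \<in> hom (power_cat C S) \<xi> \<zeta> \<Longrightarrow> FArr (proj_functor C S s) \<alpha> = NMap \<alpha> s"
  by (simp_all add: proj_functor_def homD(1))

text \<open>Evaluation is continuous because limits in C^S are componentwise; \<open>s\<close> has
  to be an object of the discrete category for this.\<close>

lemma omega_continuous_proj:
  assumes "category C" "has_omega_limits C" and s: "s \<in> S"
  shows "omega_continuous (power_cat C S) C (proj_functor C S s)" (is "omega_continuous _ _ ?F")
  unfolding omega_continuous_def
proof (intro conjI allI impI)
  interpret CS: category "power_cat C S" by (rule category_power_cat) fact
  from s have s': "s \<in> Ob (discrete S)" by simp
  show "is_functor (power_cat C S) C ?F"
  proof (rule is_functorI)
    show "FOb ?F \<xi> \<in> Ob C" if "\<xi> \<in> Ob (power_cat C S)" for \<xi>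
      using that functor_ob[OF _ s'] by (simp add: proj_functor_simps)
    show "FArr ?F \<alpha> \<in> hom C (FOb ?F \<xi>) (FOb ?F \<zeta>)" if \<alpha>: "\<alpha> \<in> hom (power_cat C S) \<xi> \<zeta>" for \<alpha> \<xi> \<zeta>
      using ntrans_component[OF \<alpha> s'] CS.hom_ob[OF \<alpha>]
      by (simp add: proj_functor_simps(1) proj_functor_simps(2)[OF \<alpha>])
    show "FArr ?F (Ident (power_cat C S) \<xi>) = Ident C (FOb ?F \<xi>)" if \<xi>: "\<xi> \<in> Ob (power_cat C S)" for \<xi>
      using s' by (simp add: proj_functor_simps(1)[OF \<xi>] proj_functor_simps(2)[OF CS.id_hom[OF \<xi>]])
    show "FArr ?F (\<alpha> \<cdot>\<^bsub>power_cat C S\<^esub> \<beta>) = FArr ?F \<alpha> \<cdot>\<^bsub>C\<^esub> FArr ?F \<beta>"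
      if \<alpha>: "\<alpha> \<in> hom (power_cat C S) \<xi> \<zeta>" and \<beta>: "\<beta> \<in> hom (power_cat C S) \<zeta> \<chi>" for \<alpha> \<beta> \<xi> \<zeta> \<chi>
      using s' by (simp add: proj_functor_simps(2)[OF \<alpha>] proj_functor_simps(2)[OF \<beta>]
          proj_functor_simps(2)[OF CS.comp_hom[OF \<alpha> \<beta>]])
  qed (simp_all add: proj_functor_def)
  fix x d L p assume L: "omega_limit (power_cat C S) x d L p"
  note l = omega_limit_facts[OF L]
  show "omega_limit C (\<lambda>n. FOb ?F (x n)) (\<lambda>n. FArr ?F (d n)) (FOb ?F L) (\<lambda>n. FArr ?F (p n))"
    unfolding proj_functor_simps(1)[OF l(1)] proj_functor_simps(1)[OF l(3)]
      proj_functor_simps(2)[OF l(2)] proj_functor_simps(2)[OF l(4)]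
    by (rule omega_limit_component[OF category_discrete assms(1,2) L s'])
qed

text \<open>Gathers what both claims share. Distributivity over the index set of the signature and
  over \<open>bool\<close> is left to the lemmas that use it, so that claim (2) can add the latter
  to claim (1).\<close>

locale signature_setting =
  fixes C :: "('o, 'm) cat" and T :: 'o and P :: "('o, 'm) prods"
    and K :: "('u, 'o, 'm) coprods" and Kbin :: "(bool, 'o, 'm) coprods" and S :: "'u set"
  assumes category: "category C"
    and terminal: "is_terminal C T"
    and products: "chosen_products C P"
    and coproducts: "\<And>J :: 'u set. chosen_coproducts C K J"
    and bin_coproducts: "chosen_coproducts C Kbin UNIV"
    and omega_limits: "has_omega_limits C"
    and distribute: "\<And>J :: 'u set. subsingleton J \<Longrightarrow> omega_limits_distribute C J"
begin

abbreviation "CS \<equiv> power_cat C S"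

lemma category_CS: "category CS"
  by (rule category_power_cat[OF category])

lemma category_E: "category (endo_cat CS)"
  by (rule category_functor_cat[OF category_CS category_CS])

lemma coproducts_C: "category_with_coproducts C K J"
  using category coproducts by (simp add: category_with_coproducts_def category_with_coproducts_axioms_def)

lemma bin_coproducts_C: "category_with_coproducts C Kbin UNIV"
  using category bin_coproducts by (simp add: category_with_coproducts_def category_with_coproducts_axioms_def)

lemma products_C: "category_with_products C P"
  using category products by (simp add: category_with_products_def category_with_products_axioms_def)

lemmas bin_coproducts_CS = coproducts_functor_cat[OF category_discrete[of S] bin_coproducts_C]
lemmas coproducts_E =
  coproducts_functor_cat[OF category_CS coproducts_functor_cat[OF category_discrete[of S] coproducts_C]]
lemmas bin_coproducts_E = coproducts_functor_cat[OF category_CS bin_coproducts_CS]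
lemmas products_E =
  products_functor_cat[OF category_CS products_functor_cat[OF category_discrete[of S] products_C]]
lemmas omega_limits_CS = has_omega_limits_functor_cat[OF category_discrete[of S] category omega_limits]

lemma T_ob: "T \<in> Ob C"
  using terminal by (simp add: is_terminal_def)

text \<open>Distributivity in C is lifted to C^S and then to its endofunctors. \<open>K'\<close> and
  its index type are general, so both \<open>K\<close> over the signature and \<open>Kbin\<close>
  over \<open>bool\<close> are covered.\<close>

lemma coproducts_preserve_E:
  assumes "category_with_coproducts C K' J" "omega_limits_distribute C J"
  shows "coproducts_preserve_omega_limits (endo_cat CS)
    (pointwise_coprods CS CS (pointwise_coprods (discrete S) C K')) J"
  by (intro coproducts_preserve_omega_limits_functor_cat category_CS category_discrete coproducts_functor_cat
      assms omega_limits omega_limits_CS category_with_coproducts.coproducts_preserve_omega_limitsI)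

text \<open>Functoriality is the goal here, since \<open>X\<close> is only precomposed with option
  functors.\<close>

lemma is_functor_option: "is_functor CS CS (option_functor C T K Kbin S s)"
  unfolding option_functor_def sum_functor_def
proof (rule is_functor_coprod[OF category_CS bin_coproducts_CS])
  have "is_functor CS CS (const_functor CS CS (hat_obj C K S s T))"
    using is_functor_hat_obj[OF coproducts_C category T_ob]
    by (intro is_functor_const category_CS) simp
  then show "is_functor CS CS (case j of True \<Rightarrow> const_functor CS CS (hat_obj C K S s T) | False \<Rightarrow> id_functor CS)" for j
    using is_functor_id[OF category_CS] by (simp split: bool.split)
qed

lemma is_functor_iterated_option: "is_functor CS CS (options_functor C T K Kbin S l)"
  by (induction l) (simp_all add: is_functor_id[OF category_CS] is_functor_comp[OF category_CS is_functor_option])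

lemma omega_continuous_hat_functor: "omega_continuous C CS (hat_functor C K S t)"
proof (rule omega_continuous_hat[OF category coproducts_C])
  fix u
  have "subsingleton (eq_proofs t u)" by (simp add: subsingleton_def eq_proofs_def)
  then show "coproducts_preserve_omega_limits C K (eq_proofs t u)"
    by (intro category_with_coproducts.coproducts_preserve_omega_limitsI coproducts_C omega_limits distribute)
qed

text \<open>Options whisker \<open>X\<close> on the left, evaluation followed by
  \<open>hat_functor\<close> on the right; continuity rests on the right side.\<close>

lemma omega_continuous_arg:
  assumes "snd a \<in> S"
  shows "omega_continuous (endo_cat CS) (endo_cat CS) (arg_functor C T K Kbin S a t)"
  unfolding arg_functor_def
  by (intro omega_continuous_whisker category_CS omega_limits_CS is_functor_iterated_option
      omega_continuous_comp[OF category_CS omega_continuous_proj[OF category omega_limits assms] omega_continuous_hat_functor])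

lemma omega_continuous_args:
  assumes "\<forall>a\<in>set as. snd a \<in> S"
  shows "omega_continuous (endo_cat CS) (endo_cat CS) (args_functor C T P K Kbin S as t)"
  using assms
\<comment> \<open>The cases match the clauses of \<open>args_functor\<close>, which ends a product
  with its last factor and so separates one-element lists from longer ones.\<close>
proof (induction as rule: induct_list012)
  case 1
  have "is_functor CS CS (comp_functor CS (const_functor CS C T) (hat_functor C K S t))"
    by (rule is_functor_comp[OF category_CS is_functor_const[OF category_CS category T_ob]
          omega_continuous_functor[OF omega_continuous_hat_functor]])
  then show ?case
    by (simp add: omega_continuous_const[OF category_E category_E])
next
  case (2 a)
  then show ?case using omega_continuous_arg[of a t] by auto
next
  case (3 a b as)
  then show ?case
    using omega_continuous_prod[OF category_E products_E omega_continuous_arg[of a t]] by auto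
qed

lemma omega_continuous_signature_functor:
  assumes "binding_signature S I ar" "omega_limits_distribute C I"
  shows "omega_continuous (endo_cat CS) (endo_cat CS) (signature_functor C T P K Kbin S I ar)"
  unfolding signature_functor_def
proof (rule omega_continuous_coprod[OF category_E coproducts_E coproducts_preserve_E[OF coproducts_C assms(2)]])
  fix i assume "i \<in> I"
  \<comment> \<open>The arity condition is brought down to the argument sorts, at which evaluation
    must be defined.\<close>
  then have "fst (ar i) \<in> lists (lists S \<times> S)"
    using funcset_mem[OF assms(1)[unfolded binding_signature_def]] by (simp only: mem_Times_iff)
  then have "\<forall>a\<in>set (fst (ar i)). snd a \<in> S"
    by (auto simp: mem_Times_iff)
  then show "omega_continuous (endo_cat CS) (endo_cat CS) (args_functor C T P K Kbin S (fst (ar i)) (snd (ar i)))"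
    by (rule omega_continuous_args)
qed

text \<open>As a functor of \<open>X\<close>, the left summand is constant, with the identity
  functor on C^S as its value.\<close>

lemma omega_continuous_id_plus:
  assumes H: "omega_continuous (endo_cat CS) (endo_cat CS) H" and "omega_limits_distribute C (UNIV :: bool set)"
  shows "omega_continuous (endo_cat CS) (endo_cat CS) (id_plus_functor C Kbin S H)"
  unfolding id_plus_functor_def sum_functor_def
proof (rule omega_continuous_coprod[OF category_E bin_coproducts_E coproducts_preserve_E[OF bin_coproducts_C assms(2)]])
  have "omega_continuous (endo_cat CS) (endo_cat CS) (const_functor (endo_cat CS) (endo_cat CS) (id_functor CS))"
    using is_functor_id[OF category_CS] by (intro omega_continuous_const category_E) simp
  then show "omega_continuous (endo_cat CS) (endo_cat CS)
      (case j of True \<Rightarrow> const_functor (endo_cat CS) (endo_cat CS) (id_functor CS) | False \<Rightarrow> H)" for j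
    using H by (simp split: bool.split)
qed

lemma final_coalgebra_endo:
  assumes "omega_continuous (endo_cat CS) (endo_cat CS) F"
  shows "\<exists>Z z. final_coalgebra (endo_cat CS) F Z z"
proof (rule category.omega_continuous_final_coalgebra[OF category_E _ _ assms])
  \<comment> \<open>Terminal objects are lifted twice: to C^S as the constant family at
    \<open>T\<close>, then to its endofunctors.\<close>
  show "is_terminal (endo_cat CS) (const_functor CS CS (const_functor (discrete S) C T))"
    by (intro is_terminal_functor_cat category_CS category_discrete category terminal)
  show "has_omega_limits (endo_cat CS)"
    by (rule has_omega_limits_functor_cat[OF category_CS category_CS omega_limits_CS])
qed

end

theorem mainTheorem3:
  fixes C :: "('o, 'm) cat" and T :: 'o and P :: "('o, 'm) prods"
    and K :: "('u, 'o, 'm) coprods" and Kbin :: "(bool, 'o, 'm) coprods"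
    and S I :: "'u set" and ar :: "'u \<Rightarrow> 'u arity"
  assumes "binding_signature S I ar"
    and "category C"
    and "is_terminal C T"
    and "chosen_products C P"
    and "\<forall>J :: 'u set. chosen_coproducts C K J"
    and "chosen_coproducts C Kbin UNIV"
    and "has_omega_limits C"
    and "\<forall>J :: 'u set. subsingleton J \<longrightarrow> omega_limits_distribute C J"
    and "omega_limits_distribute C I"
  shows "omega_continuous (endo_cat (power_cat C S)) (endo_cat (power_cat C S))
           (signature_functor C T P K Kbin S I ar) \<and>
         (omega_limits_distribute C (UNIV :: bool set) \<longrightarrow>
           omega_continuous (endo_cat (power_cat C S)) (endo_cat (power_cat C S))
             (id_plus_functor C Kbin S (signature_functor C T P K Kbin S I ar)) \<and>
           (\<exists>Z z. final_coalgebra (endo_cat (power_cat C S))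
             (id_plus_functor C Kbin S (signature_functor C T P K Kbin S I ar)) Z z))"
proof -
  interpret signature_setting C T P K Kbin S
    using assms(2-8) by (simp add: signature_setting_def)
  note H = omega_continuous_signature_functor[OF assms(1,9)]
  show ?thesis
    using H omega_continuous_id_plus[OF H] final_coalgebra_endo[OF omega_continuous_id_plus[OF H]]
    by (intro conjI impI)
qed

end
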